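(* Every space which is not CM has at most $2N_0+4$ different rational angles, where $N_0=2^6\cdot 3^4\cdot 5^3\cdot\big(\prod_{7\le p\le 37,\ p\text{ prime}}p\big)^2$.
   Context: A space is a $2$-dimensional $\mathbb{Q}$-vector subspace $V\subset\mathbb{C}$ containing two $\mathbb{R}$-linearly independent vectors. $V$ is CM if there is $\lambda\in\mathbb{C}\setminus\mathbb{Q}$ with $\lambda V\subseteq V$. A rational angle of $V$ is an ordered pair of distinct lines $(\mathbb{R}v_1,\mathbb{R}v_2)$ with $v_1,v_2\in V\setminus\{0\}$, $v_2/v_1\notin\mathbb{R}$, $\arg(v_2/v_1)\in\mathbb{Q}\pi$; rational angles obtained from each other by swapping the two lines are regarded as equivalent (not different). *)

theory Defs
  imports "HOL-Analysis.Analysis" "HOL-Computational_Algebra.Primes"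
begin

definition qspan2 :: "complex \<Rightarrow> complex \<Rightarrow> complex set" where
  "qspan2 v1 v2 = {of_rat a * v1 + of_rat b * v2 | a b. True}"

definition is_space :: "complex set \<Rightarrow> bool" where
  "is_space V \<longleftrightarrow>
     (\<exists>v1 v2. V = qspan2 v1 v2 \<and>
        (\<forall>a b. of_rat a * v1 + of_rat b * v2 = 0 \<longrightarrow> a = 0 \<and> b = 0)) \<and>
     (\<exists>u\<in>V. \<exists>w\<in>V. \<forall>s t::real. of_real s * u + of_real t * w = 0 \<longrightarrow> s = 0 \<and> t = 0)"

definition is_CM :: "complex set \<Rightarrow> bool" where
  "is_CM V \<longleftrightarrow> (\<exists>l. l \<notin> \<rat> \<and> (\<lambda>x. l * x) ` V \<subseteq> V)"

definition rline :: "complex \<Rightarrow> complex set" where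
  "rline v = {of_real t * v | t. True}"

text \<open>Rational angles of V, with an angle and its swap identified: we record the
  unordered pair of lines.\<close>
definition rational_angles :: "complex set \<Rightarrow> complex set set set" where
  "rational_angles V =
     {{rline v1, rline v2} | v1 v2.
        v1 \<in> V \<and> v2 \<in> V \<and> v1 \<noteq> 0 \<and> v2 \<noteq> 0 \<and> v2 / v1 \<notin> \<real> \<and>
        (\<exists>q\<in>\<rat>. Arg (v2 / v1) = q * pi)}"

definition N0 :: nat where
  "N0 = 2^6 * 3^4 * 5^3 * (\<Prod>p\<in>{p::nat. prime p \<and> 7 \<le> p \<and> p \<le> 37}. p)^2"

end

theory Submission
  imports Defs "HOL-Computational_Algebra.Computational_Algebra" "HOL-Number_Theory.Cong"
begin

text \<open>
  Fix a basis \<open>u, w\<close> of \<open>V\<close>. If \<open>v\<^sub>1, v\<^sub>2 \<in> V\<close> make the angle \<open>\<theta>\<close>, then \<open>cot \<theta>\<close> is the quotient of the real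
  and imaginary parts of \<open>v\<^sub>2 cnj v\<^sub>1\<close> and hence lies in the rational span of three fixed real numbers.
  Moreover, three different lines having an image in \<open>V\<close> under one and the same rotation force \<open>V\<close> to be CM,
  so each \<open>\<theta>\<close> modulo \<open>\<pi>\<close> occurs at most twice. It remains to bound the number of \<open>r \<in> (0, 1/2] \<inter> \<rat>\<close>
  whose cotangents \<open>cot (\<pi> r)\<close> span at most three dimensions over \<open>\<rat>\<close>.

  Rational relations between such cotangents are preserved under \<open>r \<mapsto> k r\<close> for \<open>k\<close> prime to the common
  denominator \<open>N\<close> (irreducibility of cyclotomic polynomials). Let \<open>p\<close> be a prime divisor of \<open>N\<close>. The cotangents
  of those \<open>r\<close> whose denominators contain the full power of \<open>p\<close> in \<open>N\<close> are not in the span of the others,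
  so passing to the others lowers the dimension and this happens at most three times. The number of
  elements \<open>r = n / N\<close> removed in a step is bounded using the conjugations \<open>r \<mapsto> r + t n / q\<close>, \<open>q\<close> a power of \<open>p\<close>:
  four of them with equal \<open>n\<close> modulo \<open>q\<close> would give a rational function of degree at most four with at
  least five zeros, and if \<open>p\<close> is large, four of them with \<open>n\<close> in no small ratio modulo \<open>p\<close> are independent, since
  a suitable conjugation makes one cotangent much larger than the other three.
\<close>

section \<open>Conjugation of roots of unity\<close>

text \<open>Coefficients stay integral, since the conjugation argument needs divisibility by a prime
  \<open>q\<close>.\<close>

definition ipeval :: "int poly \<Rightarrow> complex \<Rightarrow> complex" where
  "ipeval f z = poly (map_poly of_int f) z"

lemma ipeval_0 [simp]: "ipeval 0 z = 0"
  and ipeval_pCons [simp]: "ipeval (pCons a f) z = of_int a + z * ipeval f z"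
  by (simp_all add: ipeval_def map_poly_pCons)

lemma ipeval_1 [simp]: "ipeval 1 z = 1"
  by (simp add: one_pCons)

lemma ipeval_add [simp]: "ipeval (f + g) z = ipeval f z + ipeval g z"
  by (induction f g rule: poly_induct2) (simp_all add: algebra_simps)

lemma ipeval_smult [simp]: "ipeval (smult c f) z = of_int c * ipeval f z"
  by (induction f) (simp_all add: algebra_simps)

lemma ipeval_uminus [simp]: "ipeval (- f) z = - ipeval f z"
  by (induction f) (simp_all add: algebra_simps)

lemma ipeval_diff [simp]: "ipeval (f - g) z = ipeval f z - ipeval g z"
  using ipeval_add[of f "- g" z] by simp

lemma ipeval_mult [simp]: "ipeval (f * g) z = ipeval f z * ipeval g z"
  by (induction f) (simp_all add: algebra_simps)

lemma ipeval_power [simp]: "ipeval (f ^ n) z = ipeval f z ^ n"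
  by (induction n) simp_all

lemma ipeval_monom [simp]: "ipeval (monom c n) z = of_int c * z ^ n"
  by (induction n) (simp_all add: monom_0 monom_Suc algebra_simps)

lemma ipeval_sum [simp]: "ipeval (sum f A) z = (\<Sum>x\<in>A. ipeval (f x) z)"
  by (induction A rule: infinite_finite_induct) simp_all

lemma ipeval_pcompose [simp]: "ipeval (pcompose f g) z = ipeval f (ipeval g z)"
  by (induction f) (simp_all add: pcompose_pCons)

section \<open>The Frobenius map modulo a prime\<close>

lemma prime_dvd_power_add_diff:
  fixes x y :: "'a :: comm_ring_1"
  assumes "prime (q :: nat)"
  shows "of_nat q dvd (x + y) ^ q - x ^ q - y ^ q"
proof -
  have q: "q > 0" using assms prime_gt_0_nat by blast
  have "(x + y) ^ q = (\<Sum>k\<le>q. of_nat (q choose k) * x ^ k * y ^ (q - k))"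
    by (rule binomial_ring)
  also have "{..q} = insert 0 (insert q {1..<q})" using q by auto
  also have "(\<Sum>k\<in>\<dots>. of_nat (q choose k) * x ^ k * y ^ (q - k)) =
      y ^ q + x ^ q + (\<Sum>k\<in>{1..<q}. of_nat (q choose k) * x ^ k * y ^ (q - k))"
    using q by (subst sum.insert; simp)+
  finally have "(x + y) ^ q - x ^ q - y ^ q = (\<Sum>k\<in>{1..<q}. of_nat (q choose k) * x ^ k * y ^ (q - k))"
    by simp
  also have "of_nat q dvd \<dots>"
  proof (rule dvd_sum)
    fix k assume "k \<in> {1..<q}"
    then have "q dvd q choose k" using assms by (intro dvd_choose_prime) auto
    then have "(of_nat q :: 'a) dvd of_nat (q choose k)" by (metis dvdE dvdI of_nat_mult)
    then show "(of_nat q :: 'a) dvd of_nat (q choose k) * x ^ k * y ^ (q - k)"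
      by (simp add: mult.assoc)
  qed
  finally show ?thesis .
qed

lemma prime_dvd_power_diff_nat:
  fixes n :: nat
  assumes "prime q"
  shows "int q dvd int n ^ q - int n"
proof (induction n)
  case 0
  show ?case using prime_gt_0_nat[OF assms] by (simp add: power_0_left)
next
  case (Suc n)
  have "int q dvd (int n + 1) ^ q - int n ^ q - 1 ^ q + (int n ^ q - int n)"
    using prime_dvd_power_add_diff[OF assms, of "int n" 1] Suc by (intro dvd_add) simp_all
  then show ?case by (simp add: algebra_simps)
qed

lemma prime_dvd_power_diff_int:
  fixes a :: int
  assumes "prime q"
  shows "int q dvd a ^ q - a"
proof -
  have "[a = int (nat (a mod int q))] (mod int q)"
    using prime_gt_0_nat[OF assms] by (simp add: cong_def)
  then have "[a ^ q - a = int (nat (a mod int q)) ^ q - int (nat (a mod int q))] (mod int q)"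
    by (intro cong_diff cong_pow)
  with prime_dvd_power_diff_nat[OF assms] show ?thesis
    by (meson cong_dvd_iff cong_sym)
qed

text \<open>The Frobenius congruence, by induction on the coefficients: for a polynomial
  \<open>a + X f\<close>, additivity of the \<open>q\<close>-th power modulo \<open>q\<close>
  handles the sum, Fermat's little theorem the constant \<open>a\<close>, and the induction
  hypothesis the rest.\<close>

lemma prime_dvd_pcompose_power_diff:
  fixes f :: "int poly"
  assumes "prime (q :: nat)"
  shows "of_nat q dvd pcompose f (monom 1 q) - f ^ q"
proof (induction f)
  case 0
  show ?case using prime_gt_0_nat[OF assms] by (simp add: power_0_left)
next
  case (pCons a f)
  let ?X = "monom 1 1 :: int poly"
  have eq: "pCons a f = [:a:] + ?X * f" by (simp add: monom_altdef)
  have "[:a:] ^ q = [:a ^ q:]" by (simp add: poly_const_pow)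
  moreover have "of_nat q dvd [:a ^ q - a:]"
    using prime_dvd_power_diff_int[OF assms, of a] by (simp add: of_nat_poly dvd_def) (metis mult_pCons_right
      mult.commute smult_0_right add.right_neutral smult_pCons pCons_0_0 of_nat_poly)
  ultimately have 1: "of_nat q dvd [:a:] ^ q - [:a:]" by simp
  have 2: "of_nat q dvd (pCons a f) ^ q - [:a:] ^ q - (?X * f) ^ q"
    unfolding eq by (rule prime_dvd_power_add_diff[OF assms])
  have 3: "of_nat q dvd monom 1 q * (pcompose f (monom 1 q) - f ^ q)"
    using pCons by simp
  have X: "?X ^ q = monom 1 q" by (simp add: monom_power)
  have "pcompose (pCons a f) (monom 1 q) - pCons a f ^ q =
    monom 1 q * (pcompose f (monom 1 q) - f ^ q) - ((pCons a f) ^ q - [:a:] ^ q - (?X * f) ^ q) - ([:a:] ^ q - [:a:])"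
    by (simp add: pcompose_pCons algebra_simps power_mult_distrib X [simplified])
  with 1 2 3 show ?case by (metis dvd_diff)
qed

text \<open>Take the primitive part of a nonzero polynomial of least degree vanishing at
  \<open>z\<close>. Pseudo-division stays over the integers, and the multiplier it introduces
  cancels by Gauss's lemma because \<open>f\<close> has content 1.\<close>

lemma minimal_int_poly:
  assumes "g \<noteq> 0" "ipeval g z = 0"
  obtains f where "f \<noteq> 0" "ipeval f z = 0" "\<And>h. h \<noteq> 0 \<Longrightarrow> ipeval h z = 0 \<Longrightarrow> degree f \<le> degree h"
    "\<And>h. ipeval h z = 0 \<Longrightarrow> f dvd h"
proof -
  define f0 where "f0 = arg_min degree (\<lambda>h. h \<noteq> 0 \<and> ipeval h z = 0)"
  have f0: "f0 \<noteq> 0 \<and> ipeval f0 z = 0" 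
    unfolding f0_def by (rule arg_min_natI[of _ g]) (use assms in auto)
  have f0_min: "degree f0 \<le> degree h" if "h \<noteq> 0" "ipeval h z = 0" for h
    unfolding f0_def by (rule arg_min_nat_le) (use that in auto)
  define f where "f = primitive_part f0"
  have f0_eq: "f0 = smult (content f0) f" unfolding f_def by simp
  have c0: "content f0 \<noteq> 0" using f0 by simp
  have 1: "f \<noteq> 0" using f0 by (simp add: f_def)
  have 2: "ipeval f z = 0" using f0 c0 by (metis f0_eq ipeval_smult mult_eq_0_iff of_int_eq_0_iff)
  have 3: "degree f \<le> degree h" if "h \<noteq> 0" "ipeval h z = 0" for h
    using f0_min[OF that] by (simp add: f_def)
  have cf: "content f = 1" using f0 by (simp add: f_def)
  have 4: "f dvd h" if h: "ipeval h z = 0" for h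
  proof -
    obtain a q where aq: "a \<noteq> 0" "smult a h = f * q + pseudo_mod h f"
      using pseudo_mod(1)[OF 1] by blast
    have "ipeval (pseudo_mod h f) z = ipeval (smult a h - f * q) z" using aq by simp
    also have "\<dots> = 0" using h 2 by simp
    finally have "pseudo_mod h f = 0"
      using 3[of "pseudo_mod h f"] pseudo_mod(2)[OF 1, of h] by force
    with aq have eq: "smult a h = f * q" by simp
    then have "content (smult a h) = content q" by (simp add: content_mult cf)
    then have "a dvd content q"
      by (metis content_smult dvd_triv_left normalize_dvd_iff)
    then have "[:a:] dvd q" by (simp add: const_poly_dvd_iff_dvd_content)
    then obtain q' where "q = smult a q'" by (auto simp: dvd_def)
    with eq aq(1) have "h = f * q'" by (metis mult_smult_right smult_cancel)
    then show ?thesis by simp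
  qed
  from that[OF 1 2 3 4] show ?thesis by blast
qed

text \<open>Dedekind's argument for the irreducibility of cyclotomic polynomials. Let
  \<open>f\<close> be the minimal polynomial of \<open>z\<close> and \<open>X^N - 1 = f h\<close>.
  If \<open>f(z^q)\<close> were nonzero, \<open>z^q\<close> would be a zero of \<open>h\<close>;
  differentiating \<open>f h\<close> at \<open>z^q\<close> and the Frobenius congruence then make
  \<open>N\<close> equal to \<open>q\<close> times an integer polynomial in \<open>z\<close>, which
  contradicts that \<open>q\<close> does not divide \<open>N\<close>.\<close>

lemma ipeval_root_of_unity_prime_power:
  assumes z: "z ^ N = 1" and N: "N > 0" and q: "prime q" "\<not> q dvd N" and g: "ipeval g z = 0"
  shows "ipeval g (z ^ q) = 0"
proof -
  define X where "X = (monom 1 N - 1 :: int poly)"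
  have X: "ipeval X z = 0" using z by (simp add: X_def)
  have X_nz: "X \<noteq> 0"
  proof
    assume "X = 0"
    then have "monom (1 :: int) N = 1" by (simp add: X_def)
    then have "degree (1 :: int poly) = N" by (metis degree_monom_eq one_neq_zero)
    with N show False by simp
  qed
  obtain f where f: "f \<noteq> 0" "ipeval f z = 0" 
    and f_min: "\<And>h. h \<noteq> 0 \<Longrightarrow> ipeval h z = 0 \<Longrightarrow> degree f \<le> degree h"
    and f_dvd: "\<And>h. ipeval h z = 0 \<Longrightarrow> f dvd h"
    using minimal_int_poly[OF X_nz X] by metis
  obtain h where h: "X = f * h" using f_dvd[OF X] by auto
  define w where "w = z ^ q"
  have w: "w ^ N = 1" using z by (simp add: w_def mult.commute flip: power_mult) (simp add: power_mult)
  have "ipeval f w = 0"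
  proof (rule ccontr)
    assume fw: "ipeval f w \<noteq> 0"
    have "ipeval f w * ipeval h w = ipeval X w" by (simp add: h)
    then have hw: "ipeval h w = 0" using w fw by (simp add: X_def)
    have "pderiv X = monom (int N) (N - 1)" by (simp add: X_def pderiv_diff pderiv_monom)
    then have "of_int (int N) * w ^ (N - 1) = ipeval (pderiv (f * h)) w"
      by (simp flip: h)
    also have "\<dots> = ipeval f w * ipeval (pderiv h) w" by (simp add: pderiv_mult hw)
    finally have N1: "of_int (int N) * w ^ (N - 1) = ipeval f w * ipeval (pderiv h) w" .
    obtain H where H: "pcompose f (monom 1 q) - f ^ q = of_nat q * H"
      using prime_dvd_pcompose_power_diff[OF q(1)] by (metis dvdE)
    have "ipeval (pcompose f (monom 1 q) - f ^ q) z = ipeval f w"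
      using f(2) prime_gt_0_nat[OF q(1)] by (simp add: w_def)
    then have fwH: "ipeval f w = of_int (int q) * ipeval H z" by (simp add: H of_nat_poly)
    define G where "G = monom 1 q * pcompose (pderiv h) (monom 1 q) * H"
    have "of_int (int N) = w * (of_int (int N) * w ^ (N - 1))"
      using N w by (simp add: power_eq_if mult.left_commute)
    also have "\<dots> = of_int (int q) * ipeval G z"
      unfolding N1 fwH by (simp add: G_def w_def)
    finally have NG: "of_int (int N) = of_int (int q) * ipeval G z" .
    obtain c where "lead_coeff f * c = lead_coeff X" using h by (metis lead_coeff_mult)
    moreover have "lead_coeff X = 1"
    proof -
      have "degree (monom 1 N + (- 1) :: int poly) = N"
        using N by (subst degree_add_eq_left) (simp_all add: degree_monom_eq)
      then have "degree X = N" by (simp add: X_def)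
      then show ?thesis using N by (simp add: X_def)
    qed
    ultimately have lc: "is_unit (lead_coeff f)" by (metis dvd_triv_left)
    obtain Q R where QR: "pseudo_divmod G f = (Q, R)" by force
    \<comment> \<open>As \<open>lead_coeff f\<close> is a unit, so is the multiplier
      \<open>e\<close> of the pseudo-division, and reducing \<open>G\<close> modulo \<open>f\<close>
      loses no divisibility by \<open>q\<close>.\<close>
    define e where "e = lead_coeff f ^ (Suc (degree G) - degree f)"
    have e: "is_unit e" unfolding e_def using lc by (simp add: power_abs)
    have eG: "smult e G = f * Q + R" and R: "R = 0 \<or> degree R < degree f"
      using pseudo_divmod[OF f(1) QR] by (simp_all add: e_def)
    have f_pos: "degree f > 0"
    proof (rule ccontr)
      assume "\<not> degree f > 0"
      then obtain a where "f = [:a:]" using degree_eq_zeroE by auto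
      with f show False by simp
    qed
    \<comment> \<open>\<open>D\<close> vanishes at \<open>z\<close> and has smaller degree than
      \<open>f\<close>, so it is zero; its constant coefficient shows that \<open>q\<close> divides
      \<open>e N\<close>.\<close>
    define D where "D = smult (int q) R - [:e * int N:]"
    have "ipeval R z = ipeval (smult e G - f * Q) z" by (simp add: eG)
    also have "\<dots> = of_int e * ipeval G z" using f by simp
    finally have "ipeval D z = 0" using NG by (simp add: D_def)
    moreover have "degree D < degree f" unfolding D_def
      by (rule degree_diff_less) (use R f_pos in \<open>auto intro: le_less_trans[OF degree_smult_le]\<close>)
    ultimately have "D = 0" using f_min[of D] by force
    then have "coeff D 0 = 0" by simp
    then have "int q dvd e * int N" by (simp add: D_def) (metis dvd_triv_left)
    then have "int q dvd int N" using e by (simp add: dvd_mult_unit_iff')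
    with q(2) show False by simp
  qed
  with f_dvd[OF g] show ?thesis by (auto simp: w_def)
qed

text \<open>The prime factors of \<open>k\<close> are peeled off one at a time; each power of
  \<open>z\<close> reached is again an \<open>N\<close>-th root of unity.\<close>

lemma ipeval_root_of_unity_coprime_power:
  assumes "z ^ N = 1" "N > 0" "coprime k N" "ipeval g z = 0"
  shows "ipeval g (z ^ k) = 0"
  using assms
proof (induction k arbitrary: z rule: prime_divisors_induct)
  case zero
  then show ?case by simp
next
  case (unit k)
  then show ?case by simp
next
  case (factor p k)
  have "\<not> p dvd N" using factor by (metis coprime_common_divisor dvd_triv_left not_prime_unit)
  then have "ipeval g (z ^ p) = 0"
    using factor by (intro ipeval_root_of_unity_prime_power[of z N p g])
  moreover have "(z ^ p) ^ N = 1" using factor.prems(1) by (metis mult.commute power_mult power_one)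
  ultimately have "ipeval g ((z ^ p) ^ k) = 0"
    using factor by (intro factor.IH) auto
  then show ?case by (simp add: power_mult)
qed

section \<open>Rational relations between cotangents\<close>

text \<open>This also holds for integral \<open>r\<close>, where both sides are \<open>0\<close> because of a division by zero.\<close>
lemma cot_eq_cis:
  "complex_of_real (cot (pi * r)) = \<i> * (cis (2 * pi * r) + 1) / (cis (2 * pi * r) - 1)"
proof -
  let ?s = "complex_of_real (sin (pi * r))" and ?c = "complex_of_real (cos (pi * r))"
  have "2 * pi * r = pi * r + pi * r" by simp
  then have "cis (2 * pi * r) = cis (pi * r) ^ 2"
    unfolding power2_eq_square cis_mult by (rule arg_cong)
  also have "cis (pi * r) = ?c + \<i> * ?s" by (simp add: complex_eq_iff)
  finally have cis: "cis (2 * pi * r) = (?c + \<i> * ?s) ^ 2" .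
  have 1: "?c ^ 2 = 1 - ?s ^ 2"
    by (metis add_diff_cancel_left' sin_cos_squared_add of_real_1 of_real_add of_real_power)
  have p: "cis (2 * pi * r) + 1 = 2 * ?c * (?c + \<i> * ?s)" and m: "cis (2 * pi * r) - 1 = 2 * \<i> * ?s * (?c + \<i> * ?s)"
    unfolding cis using 1 by (simp_all add: power2_eq_square algebra_simps)
  have "?c + \<i> * ?s \<noteq> 0" using cis by (metis cis_neq_zero zero_power2)
  then show ?thesis
    unfolding p m by (simp add: cot_def mult.assoc)
qed

lemma cis_2pi_eq_1_iff: "cis (2 * pi * r) = 1 \<longleftrightarrow> r \<in> \<int>"
proof
  assume "cis (2 * pi * r) = 1"
  then have "cos (2 * pi * r) = 1" by (simp add: complex_eq_iff)
  then obtain n :: int where "2 * pi * r = of_int n * 2 * pi"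
    unfolding cos_one_2pi_int by auto
  then show "r \<in> \<int>" by simp
next
  assume "r \<in> \<int>"
  then show "cis (2 * pi * r) = 1"
    by (metis Ints_cases cis_multiple_2pi mult.commute mult.left_commute Ints_of_int)
qed

lemma cis_2pi_eq_iff: "cis (2 * pi * r) = cis (2 * pi * s) \<longleftrightarrow> r - s \<in> \<int>"
proof -
  have "cis (2 * pi * (r - s)) = cis (2 * pi * r) / cis (2 * pi * s)"
    by (simp add: cis_divide algebra_simps)
  then show ?thesis by (simp flip: cis_2pi_eq_1_iff)
qed

lemma cot_pi_eqD:
  assumes "cot (pi * r) = cot (pi * s)" "r \<notin> \<int>" "s \<notin> \<int>"
  shows "r - s \<in> \<int>"
proof -
  let ?x = "cis (2 * pi * r)" and ?y = "cis (2 * pi * s)"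
  have "(?x + 1) / (?x - 1) = (?y + 1) / (?y - 1)"
    using arg_cong[OF assms(1), of complex_of_real] unfolding cot_eq_cis
    by (simp flip: times_divide_eq_right)
  moreover have "?x - 1 \<noteq> 0" "?y - 1 \<noteq> 0" using assms(2,3) cis_2pi_eq_1_iff by auto
  ultimately have "(?x + 1) * (?y - 1) = (?y + 1) * (?x - 1)" by (simp add: frac_eq_eq)
  then have "?x = ?y" by (simp add: algebra_simps)
  then show ?thesis by (simp only: cis_2pi_eq_iff)
qed

section \<open>Galois action on relations between cotangents\<close>

lemma coprime_mult_in_Ints:
  fixes r :: real
  assumes "coprime k N" "real k * r \<in> \<int>" "real N * r \<in> \<int>"
  shows "r \<in> \<int>"
proof -
  obtain u v where "u * int k + v * int N = 1"
    using assms(1) by (metis bezout_int coprime_imp_gcd_eq_1 coprime_int_iff)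
  then have "of_int u * real k + of_int v * real N = (1 :: real)"
    by (metis of_int_1 of_int_add of_int_mult of_int_of_nat_eq)
  then have "r = of_int u * (real k * r) + of_int v * (real N * r)"
    by (metis mult.assoc distrib_right mult_1)
  then show ?thesis using assms(2,3) by (metis Ints_add Ints_mult Ints_of_int)
qed

text \<open>Up to the factor \<open>N\<close>, this makes \<open>(\<mu> + 1) / (\<mu> - 1)\<close>
  an integer polynomial in \<open>\<mu>\<close>, so that by \<open>cot_eq_cis\<close> a relation
  between cotangents becomes a polynomial equation for a root of unity.\<close>

lemma sum_of_nat_times_root_of_unity:
  fixes \<mu> :: complex
  assumes "\<mu> ^ N = 1" "\<mu> \<noteq> 1"
  shows "of_nat N + 2 * (\<Sum>j<N. of_nat j * \<mu> ^ j) = of_nat N * (\<mu> + 1) / (\<mu> - 1)"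
proof -
  have "(\<mu> - 1) * (\<Sum>j<n. of_nat j * \<mu> ^ j) = of_nat n * \<mu> ^ n - \<mu> * (\<Sum>j<n. \<mu> ^ j)" for n
    by (induction n) (simp_all add: algebra_simps)
  from this[of N] have "(\<mu> - 1) * (\<Sum>j<N. of_nat j * \<mu> ^ j) = of_nat N"
    using assms by (simp add: sum_gp_strict)
  then have "(\<mu> - 1) * (of_nat N + 2 * (\<Sum>j<N. of_nat j * \<mu> ^ j)) = of_nat N * (\<mu> + 1)"
    unfolding distrib_left[of "\<mu> - 1"] mult.left_commute[of "\<mu> - 1" 2] by (simp add: algebra_simps)
  with assms(2) show ?thesis by (metis eq_iff_diff_eq_0 nonzero_mult_div_cancel_left)
qed

text \<open>The relation says that an integer polynomial \<open>g\<close> vanishes at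
  \<open>z = exp(2 pi i / N)\<close>. Hence \<open>g\<close> vanishes at \<open>z^k\<close> too,
  which is the relation for the arguments \<open>k r\<close>.\<close>

lemma cot_relation_coprime:
  fixes c :: "real \<Rightarrow> int"
  assumes "finite F" "N > 0" and F: "\<And>r. r \<in> F \<Longrightarrow> real N * r \<in> \<int>" "\<And>r. r \<in> F \<Longrightarrow> r \<notin> \<int>"
    and rel: "(\<Sum>r\<in>F. of_int (c r) * cot (pi * r)) = 0"
    and k: "coprime k N"
  shows "(\<Sum>r\<in>F. of_int (c r) * cot (pi * (real k * r))) = 0"
proof -
  \<comment> \<open>A natural exponent with \<open>z ^ n r = cis (2 * pi * r)\<close>, also for
    negative \<open>r\<close>.\<close>
  define n where "n r = nat (\<lfloor>real N * r\<rfloor> mod int N)" for r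
  define z where "z = cis (2 * pi * (1 / real N))"
  have z: "z ^ l = cis (2 * pi * (real l / real N))" for l
    unfolding z_def Complex.DeMoivre by (simp add: field_simps)
  have zN: "z ^ N = 1" using \<open>N > 0\<close> by (simp add: z)
  have zn: "z ^ (l * n r) = cis (2 * pi * (real l * r))" if r: "r \<in> F" for r l
  proof -
    obtain a where a: "real N * r = of_int a" using F(1)[OF r] by (auto elim: Ints_cases)
    have "int (n r) = a - int N * (a div int N)"
      using \<open>N > 0\<close> by (simp add: n_def a minus_mult_div_eq_mod)
    then have "real (n r) = of_int a - real N * of_int (a div int N)"
      by (metis of_int_diff of_int_mult of_int_of_nat_eq)
    then have "real l * real (n r) = real l * (real N * r - real N * of_int (a div int N))"
      unfolding a by simp
    then have "real (l * n r) / real N = real l * r - of_int (int l * (a div int N))"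
      using \<open>N > 0\<close> by (simp add: right_diff_distrib diff_divide_distrib)
    then have "real (l * n r) / real N - real l * r \<in> \<int>" by simp
    then show ?thesis unfolding z cis_2pi_eq_iff .
  qed
  define g where "g = (\<Sum>r\<in>F. smult (c r) ([:int N:] + (\<Sum>j<N. monom (2 * int j) (j * n r))))"
  have g: "ipeval g (z ^ l) = - \<i> * of_nat N * of_real (\<Sum>r\<in>F. of_int (c r) * cot (pi * (real l * r)))"
    if "coprime l N" for l
  proof -
    have "ipeval [:int N:] (z ^ l) + (\<Sum>j<N. ipeval (monom (2 * int j) (j * n r)) (z ^ l)) =
        - \<i> * of_nat N * of_real (cot (pi * (real l * r)))" if r: "r \<in> F" for r
    proof -
      let ?m = "cis (2 * pi * (real l * r))"
      have "(z ^ l) ^ (j * n r) = ?m ^ j" for j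
        using zn[OF r, of l] by (metis mult.left_commute power_mult mult.commute)
      then have "ipeval [:int N:] (z ^ l) + (\<Sum>j<N. ipeval (monom (2 * int j) (j * n r)) (z ^ l)) =
          of_nat N + 2 * (\<Sum>j<N. of_nat j * ?m ^ j)"
        by (simp add: sum_distrib_left mult.assoc)
      also have "\<dots> = of_nat N * (?m + 1) / (?m - 1)"
      proof (rule sum_of_nat_times_root_of_unity)
        show "?m ^ N = 1"
          using zn[OF r, of l] zN by (metis mult.commute power_mult power_one)
        show "?m \<noteq> 1"
        proof
          assume "?m = 1"
          then have "real l * r \<in> \<int>" by (simp add: cis_2pi_eq_1_iff)
          then have "r \<in> \<int>" using coprime_mult_in_Ints[OF \<open>coprime l N\<close>] F(1)[OF r] by blast
          with F(2)[OF r] show False by blast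
        qed
      qed
      also have "\<dots> = - \<i> * of_nat N * of_real (cot (pi * (real l * r)))"
        by (simp add: cot_eq_cis field_simps)
      finally show ?thesis .
    qed
    then show ?thesis
      by (simp add: g_def sum_distrib_left mult.left_commute)
  qed
  from rel g[of 1] have "ipeval g z = 0" by simp
  then have "ipeval g (z ^ k) = 0"
    using zN \<open>N > 0\<close> k by (intro ipeval_root_of_unity_coprime_power)
  with g[OF k] \<open>N > 0\<close> show ?thesis
    by (simp del: of_real_sum)
qed

text \<open>Clearing denominators gives a polynomial of degree at most \<open>card F\<close> with
  more than \<open>card F\<close> zeros, hence the zero polynomial. At \<open>1 / \<mu> r\<close>
  only the summand with coefficient \<open>c r\<close> survives.\<close>

lemma moebius_sum_eq_0:
  fixes \<mu> c :: "'b \<Rightarrow> complex"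
  assumes F: "finite F" "inj_on \<mu> F" "\<And>r. r \<in> F \<Longrightarrow> \<mu> r \<noteq> 0"
    and Z: "card F < card Z" "\<And>z r. z \<in> Z \<Longrightarrow> r \<in> F \<Longrightarrow> \<mu> r * z \<noteq> 1"
      "\<And>z. z \<in> Z \<Longrightarrow> (\<Sum>r\<in>F. c r * ((\<mu> r * z + 1) / (\<mu> r * z - 1))) = 0"
    and r: "r \<in> F"
  shows "c r = 0"
proof -
  define P where "P = (\<Sum>r\<in>F. smult (c r) ([:1, \<mu> r:] * (\<Prod>s\<in>F - {r}. [:-1, \<mu> s:])))"
  have P_eval: "poly P z = (\<Sum>r\<in>F. c r * ((\<mu> r * z + 1) * (\<Prod>s\<in>F - {r}. \<mu> s * z - 1)))" for z
    by (simp add: P_def poly_sum poly_prod algebra_simps)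
  have "P = 0"
  proof (rule ccontr)
    assume P: "P \<noteq> 0"
    have "degree P \<le> card F"
      unfolding P_def
    proof (rule degree_sum_le[OF F(1)])
      fix r assume r: "r \<in> F"
      have "degree (smult (c r) ([:1, \<mu> r:] * (\<Prod>s\<in>F - {r}. [:-1, \<mu> s:])))
          \<le> degree ([:1, \<mu> r:] * (\<Prod>s\<in>F - {r}. [:-1, \<mu> s:]))"
        by (rule degree_smult_le)
      also have "\<dots> \<le> degree [:1, \<mu> r:] + degree (\<Prod>s\<in>F - {r}. [:-1, \<mu> s:])"
        by (rule degree_mult_le)
      also have "\<dots> \<le> 1 + (\<Sum>s\<in>F - {r}. 1)"
        by (intro add_mono order.trans[OF degree_prod_sum_le] sum_mono) (use F in auto)
      also have "\<dots> = card F" using card.remove[OF F(1) r] by simp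
      finally show "degree (smult (c r) ([:1, \<mu> r:] * (\<Prod>s\<in>F - {r}. [:-1, \<mu> s:]))) \<le> card F" .
    qed
    moreover have "card Z \<le> card {z. poly P z = 0}"
    proof (rule card_mono[OF poly_roots_finite[OF P]], rule subsetI, rule CollectI)
      fix z assume z: "z \<in> Z"
      have "poly P z = (\<Sum>r\<in>F. (\<Prod>s\<in>F. \<mu> s * z - 1) * (c r * ((\<mu> r * z + 1) / (\<mu> r * z - 1))))"
        unfolding P_eval
      proof (rule sum.cong[OF refl])
        fix r assume r: "r \<in> F"
        have "(\<Prod>s\<in>F. \<mu> s * z - 1) = (\<mu> r * z - 1) * (\<Prod>s\<in>F - {r}. \<mu> s * z - 1)"
          by (rule prod.remove[OF F(1) r])
        then show "c r * ((\<mu> r * z + 1) * (\<Prod>s\<in>F - {r}. \<mu> s * z - 1)) =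
          (\<Prod>s\<in>F. \<mu> s * z - 1) * (c r * ((\<mu> r * z + 1) / (\<mu> r * z - 1)))"
          using Z(2)[OF z r] by simp
      qed
      then show "poly P z = 0" unfolding sum_distrib_left [symmetric] Z(3)[OF z] by simp
    qed
    ultimately show False using card_poly_roots_bound[OF P] Z(1) by simp
  qed
  define z where "z = 1 / \<mu> r"
  have z: "\<mu> s * z = 1 \<longleftrightarrow> s = r" if "s \<in> F" for s
    using F(2) F(3)[OF r] that r by (auto simp: z_def inj_on_def)
  have "(\<Sum>s\<in>F - {r}. c s * ((\<mu> s * z + 1) * (\<Prod>t\<in>F - {s}. \<mu> t * z - 1))) = 0"
  proof (rule sum.neutral, rule ballI)
    fix s assume s: "s \<in> F - {r}"
    have "(\<Prod>t\<in>F - {s}. \<mu> t * z - 1) = 0"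
      by (rule prod_zero) (use F(1) r s z in auto)
    then show "c s * ((\<mu> s * z + 1) * (\<Prod>t\<in>F - {s}. \<mu> t * z - 1)) = 0" by simp
  qed
  with P_eval[of z] sum.remove[OF F(1) r, of "\<lambda>s. c s * ((\<mu> s * z + 1) * (\<Prod>t\<in>F - {s}. \<mu> t * z - 1))"]
  have "c r * ((\<mu> r * z + 1) * (\<Prod>s\<in>F - {r}. \<mu> s * z - 1)) = 0"
    by (simp only: \<open>P = 0\<close> poly_0 add_0_right)
  moreover have "(\<Prod>s\<in>F - {r}. \<mu> s * z - 1) \<noteq> 0" using z F(1) by auto
  moreover have "\<mu> r * z + 1 \<noteq> 0" using z[OF r] by simp
  ultimately show ?thesis by simp
qed

text \<open>Linear dependence over the rationals with denominators cleared, as integer polynomials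
  require.\<close>

definition cot_dependent :: "real set \<Rightarrow> bool" where
  "cot_dependent F \<longleftrightarrow> (\<exists>c :: real \<Rightarrow> int. (\<exists>r\<in>F. c r \<noteq> 0) \<and> (\<Sum>r\<in>F. of_int (c r) * cot (pi * r)) = 0)"

section \<open>Conjugations that shift by multiples of 1/q\<close>

lemma not_in_Ints_half_interval:
  fixes r :: real
  assumes "r \<in> {0<..1/2}"
  shows "r \<notin> \<int>"
proof
  assume "r \<in> \<int>"
  then obtain n where "r = of_int n" by (auto elim: Ints_cases)
  with assms have "0 < n" "2 * n \<le> 1" by auto
  then show False by simp
qed

lemma diff_in_Ints_half_interval:
  fixes r s :: real
  assumes "r \<in> {0<..1/2}" "s \<in> {0<..1/2}" "r - s \<in> \<int>"
  shows "r = s"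
proof -
  obtain n where n: "r - s = of_int n" using assms(3) by (auto elim: Ints_cases)
  with assms have "- 1 < real_of_int n" "real_of_int n < 1" by auto
  then have "n = 0" by linarith
  with n show ?thesis by simp
qed

text \<open>The multipliers \<open>1 + (N / q) t\<close> are the conjugations used throughout; the
  translation depends, modulo 1, only on \<open>t\<close> and on \<open>n\<close> modulo
  \<open>q\<close>.\<close>

lemma shifted_multiple:
  fixes r :: real
  assumes "q dvd N" "N > 0" "real N * r = of_int n"
  shows "real (1 + N div q * t) * r = r + of_int (int t * n) / real q"
proof -
  have "real (N div q) = real N / real q" using assms(1) by (simp add: real_of_nat_div)
  then have "real (N div q) * real t * r = real t * (real N * r) / real q" by simp
  then show ?thesis unfolding assms(3) by (simp add: algebra_simps)
qed

text \<open>With equal residues, conjugation by \<open>1 + (N / q) t\<close> multiplies every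
  \<open>cis (2 * pi * r)\<close> by the same \<open>z t\<close>. A relation would thus give a sum
  of Moebius transforms with more than \<open>card F\<close> zeros, forcing all coefficients to
  vanish.\<close>

lemma cot_independent_same_residue:
  assumes F: "finite F" "F \<subseteq> {0<..1/2}" 
    and num: "\<And>r. r \<in> F \<Longrightarrow> real N * r = of_int (num r)" "\<And>r. r \<in> F \<Longrightarrow> [num r = a] (mod int q)"
    and q: "q dvd N" "N > 0" "coprime a (int q)"
    and T: "T \<subseteq> {..<q}" "\<And>t. t \<in> T \<Longrightarrow> coprime (1 + N div q * t) N" "card F < card T"
  shows "\<not> cot_dependent F"
proof
  assume "cot_dependent F"
  then obtain c r0 where r0: "r0 \<in> F" "c r0 \<noteq> 0" and rel: "(\<Sum>r\<in>F. of_int (c r) * cot (pi * r)) = 0"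
    unfolding cot_dependent_def by auto
  have q0: "q > 0" using q by (auto intro: Nat.gr0I)
  define \<mu> where "\<mu> r = cis (2 * pi * r)" for r
  define z where "z t = cis (2 * pi * (of_int (int t * a) / real q))" for t
  have mult: "cis (2 * pi * (real (1 + N div q * t) * r)) = \<mu> r * z t" if r: "r \<in> F" for r t
  proof -
    obtain b where b: "num r = a + int q * b" using num(2)[OF r] by (metis cong_iff_lin cong_sym)
    have "real (1 + N div q * t) * r = r + of_int (int t * num r) / real q"
      by (rule shifted_multiple[OF q(1,2) num(1)[OF r]])
    also have "\<dots> = (r + of_int (int t * a) / real q) + of_int (int t * b)"
      using q0 by (simp add: b field_simps)
    finally have "cis (2 * pi * (real (1 + N div q * t) * r)) = cis (2 * pi * (r + of_int (int t * a) / real q))"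
      unfolding cis_2pi_eq_iff by simp
    also have "\<dots> = \<mu> r * z t" by (simp add: \<mu>_def z_def cis_mult ring_distribs)
    finally show ?thesis .
  qed
  \<comment> \<open>\<open>a\<close> is invertible modulo \<open>q\<close>, so distinct
    \<open>t < q\<close> give distinct points.\<close>
  have "inj_on z T"
  proof (rule inj_onI)
    fix t t' assume t: "t \<in> T" "t' \<in> T" "z t = z t'"
    then have "of_int (int t * a) / real q - of_int (int t' * a) / real q \<in> \<int>"
      unfolding z_def cis_2pi_eq_iff by simp
    then obtain m where "of_int (int t * a) / real q - of_int (int t' * a) / real q = of_int m"
      by (auto elim: Ints_cases)
    then have "of_int ((int t - int t') * a) = real_of_int (int q * m)"
      using q0 by (simp add: field_simps)
    then have "int q dvd (int t - int t') * a" by (metis dvd_triv_left of_int_eq_iff)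
    then have "int q dvd int t - int t'" using q(3) by (simp add: coprime_commute coprime_dvd_mult_left_iff)
    moreover have "t < q" "t' < q" using t T by auto
    ultimately show "t = t'"
      by (metis cong_iff_dvd_diff cong_int_iff cong_less_modulus_unique_nat)
  qed
  then have card: "card (z ` T) = card T" by (rule card_image)
  have "complex_of_int (c r0) = 0"
  proof (rule moebius_sum_eq_0[where F = F and \<mu> = \<mu> and Z = "z ` T"])
    show "inj_on \<mu> F"
      using F(2) by (auto simp: inj_on_def \<mu>_def cis_2pi_eq_iff intro!: diff_in_Ints_half_interval)
    show "card F < card (z ` T)" using card T by simp
    fix w assume "w \<in> z ` T"
    then obtain t where t: "t \<in> T" "w = z t" by auto
    have int: "real N * r \<in> \<int>" "r \<notin> \<int>" if "r \<in> F" for r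
      using num(1)[OF that] not_in_Ints_half_interval F(2) that by auto
    show "\<mu> r * w \<noteq> 1" if r: "r \<in> F" for r
      using coprime_mult_in_Ints[OF T(2)[OF t(1)], of r] int[OF r]
      by (auto simp: t simp flip: mult[OF r] cis_2pi_eq_1_iff)
    have cot: "complex_of_real (cot (pi * (real (1 + N div q * t) * r))) = \<i> * ((\<mu> r * w + 1) / (\<mu> r * w - 1))"
      if "r \<in> F" for r
      unfolding cot_eq_cis mult[OF that] t by simp
    have "(\<Sum>r\<in>F. of_int (c r) * cot (pi * (real (1 + N div q * t) * r))) = 0"
      by (rule cot_relation_coprime[OF F(1) q(2) int rel T(2)[OF t(1)]])
    then have "0 = complex_of_real (\<Sum>r\<in>F. of_int (c r) * cot (pi * (real (1 + N div q * t) * r)))"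
      by simp
    also have "\<dots> = (\<Sum>r\<in>F. of_int (c r) * complex_of_real (cot (pi * (real (1 + N div q * t) * r))))"
      unfolding of_real_sum of_real_mult of_real_of_int_eq ..
    also have "\<dots> = \<i> * (\<Sum>r\<in>F. of_int (c r) * ((\<mu> r * w + 1) / (\<mu> r * w - 1)))"
      unfolding sum_distrib_left by (rule sum.cong[OF refl]) (simp only: cot mult.left_commute)
    finally show "(\<Sum>r\<in>F. of_int (c r) * ((\<mu> r * w + 1) / (\<mu> r * w - 1))) = 0" by simp
  qed (use r0 F in \<open>auto simp: \<mu>_def\<close>)
  with r0 show False by simp
qed

section \<open>Size of the cotangent\<close>

lemma cot_mono_decreasing:
  fixes x y :: real
  assumes "0 < x" "x \<le> y" "y < pi"
  shows "cot y \<le> cot x"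
proof -
  have s: "sin x > 0" "sin y > 0" using assms by (auto intro!: sin_gt_zero)
  have "sin (y - x) \<ge> 0" using assms by (intro sin_ge_zero) auto
  then have "cos y * sin x \<le> cos x * sin y" by (simp add: sin_diff mult.commute)
  then show ?thesis using s by (simp add: cot_def divide_simps)
qed

lemma cot_nonneg: "0 \<le> x \<Longrightarrow> x \<le> pi / 2 \<Longrightarrow> 0 \<le> cot (x :: real)"
  unfolding cot_def using pi_gt_zero by (intro divide_nonneg_nonneg cos_ge_zero sin_ge_zero) linarith+

lemma cot_plus_of_int_times_pi: "cot (x + pi * of_int n) = cot (x :: real)"
proof -
  have "cis (2 * pi * (x / pi + of_int n)) = cis (2 * pi * (x / pi))"
    unfolding cis_2pi_eq_iff by simp
  then have "complex_of_real (cot (pi * (x / pi + of_int n))) = complex_of_real (cot (pi * (x / pi)))"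
    by (simp only: cot_eq_cis)
  then show ?thesis by (simp add: distrib_left)
qed

text \<open>Periodicity and oddness move the argument to the distance from the nearest integer,
  which is at most 1/2, where the cotangent is nonnegative.\<close>

lemma abs_cot_pi_round: "\<bar>cot (pi * x)\<bar> = cot (pi * \<bar>x - of_int (round x)\<bar>)"
proof -
  have r: "\<bar>x - of_int (round x)\<bar> \<le> 1/2" using of_int_round_abs_le[of x] by (simp add: abs_minus_commute)
  have abs_cot: "\<bar>cot (pi * y)\<bar> = \<bar>cot (pi * \<bar>y\<bar>)\<bar>" for y :: real
    by (cases "y \<ge> 0") (simp_all add: cot_def abs_of_neg)
  have "cot (pi * x) = cot (pi * (x - of_int (round x)) + pi * of_int (round x))"
    by (simp add: algebra_simps)
  also have "\<dots> = cot (pi * (x - of_int (round x)))" by (rule cot_plus_of_int_times_pi)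
  also have "\<bar>\<dots>\<bar> = \<bar>cot (pi * \<bar>x - of_int (round x)\<bar>)\<bar>"
    by (rule abs_cot)
  also have "\<dots> = cot (pi * \<bar>x - of_int (round x)\<bar>)"
  proof -
    have "pi * \<bar>x - of_int (round x)\<bar> \<le> pi * (1/2)" using r by (intro mult_left_mono) auto
    moreover have "0 \<le> pi * \<bar>x - of_int (round x)\<bar>" by simp
    ultimately show ?thesis using cot_nonneg by simp
  qed
  finally show ?thesis .
qed

lemma abs_cot_le:
  assumes "\<And>l :: int. d \<le> \<bar>x - of_int l\<bar>" "0 < d"
  shows "\<bar>cot (pi * x)\<bar> \<le> cot (pi * d)"
proof -
  have r: "\<bar>x - of_int (round x)\<bar> \<le> 1/2" using of_int_round_abs_le[of x] by (simp add: abs_minus_commute)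
  have "pi * \<bar>x - of_int (round x)\<bar> \<le> pi * (1/2)" using r by (intro mult_left_mono) auto
  then show ?thesis
    unfolding abs_cot_pi_round using assms pi_gt_zero
    by (intro cot_mono_decreasing) (auto intro: le_less_trans)
qed

lemma abs_cot_ge:
  assumes "\<bar>x - of_int l\<bar> \<le> d" "x \<notin> \<int>" "d < 1/2"
  shows "cot (pi * d) \<le> \<bar>cot (pi * x)\<bar>"
proof -
  have "round x = l" using assms by (intro round_unique') auto
  moreover have "x - of_int l \<noteq> 0" using assms(2) by (metis Ints_of_int eq_iff_diff_eq_0)
  moreover have "pi * d < pi" using assms by simp
  ultimately show ?thesis
    unfolding abs_cot_pi_round using assms by (intro cot_mono_decreasing) auto
qed

text \<open>With \<open>s = sin x\<close> and \<open>c = cos x\<close>, the triple-angle formulas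
  give \<open>cot (3 x) / cot x = (c^2 - 3 s^2) / (3 c^2 - s^2)\<close>, and
  \<open>3 (c^2 - 3 s^2)\<close> is smaller than \<open>3 c^2 - s^2\<close> by
  \<open>8 s^2\<close>.\<close>

lemma cot_triple_less:
  fixes x :: real
  assumes "0 < x" "3 * x < pi / 2"
  shows "3 * cot (3 * x) < cot x"
proof -
  define s c where "s = sin x" and "c = cos x"
  have s: "s > 0" unfolding s_def using assms by (intro sin_gt_zero) auto
  have s3: "sin (3 * x) > 0" using assms by (intro sin_gt_zero) auto
  have c: "c > 0" unfolding c_def using assms by (intro cos_gt_zero) auto
  have cs: "c\<^sup>2 = 1 - s\<^sup>2" unfolding s_def c_def by (simp add: cos_squared_eq)
  have e: "3 * x = 2 * x + x" by simp
  have sin3: "sin (3 * x) = s * (3 * c\<^sup>2 - s\<^sup>2)" and cos3: "cos (3 * x) = c * (c\<^sup>2 - 3 * s\<^sup>2)"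
    unfolding e sin_add cos_add sin_double cos_double s_def [symmetric] c_def [symmetric]
    by (simp_all add: power2_eq_square algebra_simps)
  have pos: "3 * c\<^sup>2 - s\<^sup>2 > 0" using s3 s unfolding sin3 by (simp add: zero_less_mult_iff)
  have "3 * (c\<^sup>2 - 3 * s\<^sup>2) < 3 * c\<^sup>2 - s\<^sup>2" using s by simp
  then have "3 * (c\<^sup>2 - 3 * s\<^sup>2) / (3 * c\<^sup>2 - s\<^sup>2) < 1" using pos by simp
  then have "c / s * (3 * (c\<^sup>2 - 3 * s\<^sup>2) / (3 * c\<^sup>2 - s\<^sup>2)) < c / s * 1"
    using s c by (intro mult_strict_left_mono) auto
  then show ?thesis by (simp add: cot_def sin3 cos3 flip: s_def c_def) (simp add: field_simps)
qed

text \<open>A conjugation is chosen that makes the argument of the cotangent with the dominant coefficient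
  at most \<open>(9/2) \<pi> / p\<close> and keeps the others at distance at least \<open>(27/2) \<pi> / p\<close> from the poles. As
  \<open>3 cot (3 x) < cot x\<close>, the three other terms cannot compensate it. Five candidates for the conjugation
  suffice: each other term excludes at most one, and so does coprimality.\<close>
lemma cot_independent_no_small_ratio:
  assumes F: "finite F" "F \<noteq> {}" "F \<subseteq> {0<..1/2}" "card F \<le> 4"
    and num: "\<And>r. r \<in> F \<Longrightarrow> real N * r = of_int (num r)" "\<And>r. r \<in> F \<Longrightarrow> \<not> int p dvd num r"
    and p: "prime p" "p dvd N" "N > 0" "p \<ge> 29"
    and T: "\<And>t t'. t < p \<Longrightarrow> t' < p \<Longrightarrow> \<not> coprime (1 + N div p * t) N \<Longrightarrow>
                \<not> coprime (1 + N div p * t') N \<Longrightarrow> t = t'"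
    and ratio: "\<And>r s v w. r \<in> F \<Longrightarrow> s \<in> F \<Longrightarrow> r \<noteq> s \<Longrightarrow> v \<in> {1..4} \<Longrightarrow> w \<in> {-26..26} \<Longrightarrow>
                  \<not> int p dvd v * num r - w * num s"
  shows "\<not> cot_dependent F"
proof
  assume "cot_dependent F"
  then obtain c r0 where r0: "r0 \<in> F" "c r0 \<noteq> 0" and rel: "(\<Sum>r\<in>F. of_int (c r) * cot (pi * r)) = 0"
    unfolding cot_dependent_def by auto
  have int: "real N * r \<in> \<int>" "r \<notin> \<int>" if "r \<in> F" for r
    using num(1)[OF that] not_in_Ints_half_interval F(3) that by auto
  \<comment> \<open>\<open>i\<close> carries the coefficient of largest absolute value; its term is
    to dominate.\<close>
  have "Max ((\<lambda>r. \<bar>c r\<bar>) ` F) \<in> (\<lambda>r. \<bar>c r\<bar>) ` F" using F(1,2) by (intro Max_in) auto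
  then obtain i where i: "i \<in> F" "\<bar>c i\<bar> = Max ((\<lambda>r. \<bar>c r\<bar>) ` F)" by auto
  have i: "i \<in> F" "\<And>r. r \<in> F \<Longrightarrow> \<bar>c r\<bar> \<le> \<bar>c i\<bar>"
    using i F(1) by auto
  have ci: "\<bar>c i\<bar> > 0" using i(2)[OF r0(1)] r0(2) by auto
  have p0: "p > 0" using p by simp
  have cop: "coprime (num i) (int p)"
    using num(2)[OF i(1)] p(1) by (metis coprime_commute prime_imp_coprime prime_nat_int_transfer)
  obtain a where a: "[num i * a = 1] (mod int p)"
    using cop by (metis cong_solve_coprime_int)
  define m where "m = round (real p * i)"
  have m: "\<bar>real p * i - of_int m\<bar> \<le> 1/2"
    using of_int_round_abs_le[of "real p * i"] by (simp add: m_def abs_minus_commute)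
  \<comment> \<open>\<open>t u\<close> is chosen so that \<open>t u * num i\<close> is congruent to
    \<open>u - m\<close>; for \<open>u \<le> 4\<close>, \<open>p\<close> times the conjugate of
    \<open>i\<close> then lies within \<open>1/2 + 4\<close> of a multiple of
    \<open>p\<close>.\<close>
  define t where "t u = nat ((int u - m) * a mod int p)" for u :: nat
  have t: "int (t u) = (int u - m) * a mod int p" "t u < p" for u
    using p0 by (simp_all add: t_def nat_less_iff)
  have t_num: "[int (t u) * num r = (int u - m) * a * num r] (mod int p)" for u r
    unfolding t by (metis cong_mod_left cong_mult cong_refl)
  have ex: "\<exists>l. real p * (real (1 + N div p * t u) * r) = real p * r + of_int ((int u - m) * a * num r) + real p * of_int l"
    if "r \<in> F" for u r
  proof -
    obtain l where l: "int (t u) * num r = (int u - m) * a * num r + int p * l"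
      using t_num[of u r] by (metis cong_iff_lin cong_sym)
    have "real (1 + N div p * t u) * r = r + of_int (int (t u) * num r) / real p"
      by (rule shifted_multiple[OF p(2,3) num(1)[OF that]])
    then have "real p * (real (1 + N div p * t u) * r) = real p * r + of_int (int (t u) * num r)"
      using p0 by (simp add: field_simps)
    then show ?thesis unfolding l by auto
  qed
  define bad where "bad r u \<longleftrightarrow> (\<exists>l. \<bar>real (1 + N div p * t u) * r - of_int l\<bar> < 27/2 / real p)" for r u
  have bad_unique: "\<not> (bad r u \<and> bad r u')" if r: "r \<in> F - {i}" and u: "u < u'" "u' < 5" for r u u'
  proof
    assume "bad r u \<and> bad r u'"
    then obtain l l' where "\<bar>real (1 + N div p * t u) * r - of_int l\<bar> < 27/2 / real p"
      and "\<bar>real (1 + N div p * t u') * r - of_int l'\<bar> < 27/2 / real p"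
      unfolding bad_def by blast
    then have l: "\<bar>real p * (real (1 + N div p * t u) * r) - real p * of_int l\<bar> < 27/2"
      and l': "\<bar>real p * (real (1 + N div p * t u') * r) - real p * of_int l'\<bar> < 27/2"
      using p0 by (simp_all add: pos_less_divide_eq abs_mult_pos flip: right_diff_distrib) 
        (simp_all add: mult.commute abs_mult)
    obtain k k' where k: "real p * (real (1 + N div p * t u) * r) = real p * r + of_int ((int u - m) * a * num r) + real p * of_int k"
      and k': "real p * (real (1 + N div p * t u') * r) = real p * r + of_int ((int u' - m) * a * num r) + real p * of_int k'"
      using ex[of r u] ex[of r u'] r by blast
    \<comment> \<open>If \<open>u\<close> and \<open>u'\<close> were both bad for \<open>r\<close>,
      the difference \<open>w\<close> of the two near misses would be an integer of size below 27
      with \<open>(u' - u) * num r\<close> congruent to \<open>w * num i\<close>, a ratio that is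
      excluded.\<close>
    define w where "w = (int u' - int u) * a * num r + int p * (k' - l' - k + l)"
    have "real_of_int w = (real p * (real (1 + N div p * t u') * r) - real p * of_int l') -
        (real p * (real (1 + N div p * t u) * r) - real p * of_int l)"
      unfolding k k' w_def by (simp add: algebra_simps)
    with l l' have "\<bar>real_of_int w\<bar> < 27" by linarith
    then have w: "w \<in> {-26..26}" by auto
    have "[w = (int u' - int u) * a * num r] (mod int p)" by (simp add: w_def cong_def)
    then have "[w * num i = (int u' - int u) * a * num r * num i] (mod int p)" by (rule cong_scalar_right)
    also have "(int u' - int u) * a * num r * num i = (int u' - int u) * num r * (num i * a)" by simp
    also have "[\<dots> = (int u' - int u) * num r * 1] (mod int p)" by (rule cong_scalar_left[OF a])
    finally have "int p dvd (int u' - int u) * num r - w * num i"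
      by (metis cong_iff_dvd_diff cong_sym mult.right_neutral)
    with ratio[of r i "int u' - int u" w] r i(1) u w show False by auto
  qed
  have "inj_on t {..<5}"
  proof (rule inj_onI)
    fix u u' assume u: "u \<in> {..<5}" "u' \<in> {..<5}" "t u = t u'"
    then have "[(int u - m) * a = (int u' - m) * a] (mod int p)" by (metis t(1) cong_def)
    then have "[(int u - m) * a * num i = (int u' - m) * a * num i] (mod int p)" by (rule cong_scalar_right)
    then have "[(int u - m) * (num i * a) = (int u' - m) * (num i * a)] (mod int p)" by (simp add: mult_ac)
    moreover have "[(int v - m) * (num i * a) = (int v - m) * 1] (mod int p)" for v
      by (rule cong_scalar_left[OF a])
    ultimately have "[int u - m = int u' - m] (mod int p)" by (metis cong_sym cong_trans mult.right_neutral)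
    then have "[u = u'] (mod p)" by (simp add: cong_iff_dvd_diff flip: cong_int_iff)
    then show "u = u'" using u p(4) by (intro cong_less_modulus_unique_nat[of u u' p]) auto
  qed
  \<comment> \<open>At most one of the five candidates is lost per element of \<open>F\<close>: the
    slot of \<open>i\<close>, whose term is meant to come close to a pole, counts the failure of
    coprimality instead.\<close>
  define B where "B r = (if r = i then {u \<in> {..<5}. \<not> coprime (1 + N div p * t u) N} else {u \<in> {..<5 :: nat}. bad r u})" for r
  have "card (B r) \<le> 1" if r: "r \<in> F" for r
  proof (rule card_le_Suc0_iff_eq [THEN iffD2, unfolded One_nat_def [symmetric]])
    show "finite (B r)" by (simp add: B_def)
    show "\<forall>u\<in>B r. \<forall>u'\<in>B r. u = u'"
    proof (intro ballI)
      fix u u' assume u: "u \<in> B r" "u' \<in> B r"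
      show "u = u'"
      proof (cases "r = i")
        case True
        then have "t u = t u'" using u T[OF t(2) t(2)] by (simp add: B_def)
        with True u \<open>inj_on t {..<5}\<close> show ?thesis by (auto simp: B_def inj_on_def)
      next
        case False
        with r u bad_unique[of r u u'] bad_unique[of r u' u] show ?thesis
          by (cases u u' rule: linorder_cases) (auto simp: B_def)
      qed
    qed
  qed
  then have "(\<Sum>r\<in>F. card (B r)) \<le> (\<Sum>r\<in>F. 1)" by (rule sum_mono)
  then have "card (\<Union>r\<in>F. B r) \<le> 4"
    using card_UN_le[OF F(1), of B] F(4) by simp
  then have "\<not> {..<5} \<subseteq> (\<Union>r\<in>F. B r)"
    using card_mono[of "\<Union>r\<in>F. B r" "{..<5 :: nat}"] F(1) by (auto simp: B_def)
  then obtain u where u: "u < 5" "u \<notin> (\<Union>r\<in>F. B r)" by auto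
  have cop_u: "coprime (1 + N div p * t u) N" using u i(1) by (auto simp: B_def)
  have not_bad: "\<not> bad r u" if "r \<in> F - {i}" for r using u that by (auto simp: B_def)
  define K where "K = real (1 + N div p * t u)"
  have K: "K * r \<notin> \<int>" if "r \<in> F" for r
    using coprime_mult_in_Ints[OF cop_u, of r] int[OF that] by (auto simp: K_def)
  have sum0: "(\<Sum>r\<in>F. of_int (c r) * cot (pi * (K * r))) = 0"
    unfolding K_def by (rule cot_relation_coprime[OF F(1) p(3) int rel cop_u])
  have small: "\<bar>cot (pi * (K * r))\<bar> \<le> cot (pi * (27/2 / real p))" if "r \<in> F - {i}" for r
  proof (rule abs_cot_le)
    show "27/2 / real p \<le> \<bar>K * r - of_int l\<bar>" for l
      using not_bad[OF that] unfolding bad_def K_def by (simp add: not_less)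
  qed (use p0 in simp)
  have large: "cot (pi * (9/2 / real p)) \<le> \<bar>cot (pi * (K * i))\<bar>"
  proof -
    obtain l where l: "real p * (K * i) = real p * i + of_int ((int u - m) * a * num i) + real p * of_int l"
      using ex[OF i(1), of u] unfolding K_def by blast
    have "[(int u - m) * (num i * a) = (int u - m) * 1] (mod int p)" by (rule cong_scalar_left[OF a])
    then have "[(int u - m) * a * num i = int u - m] (mod int p)" by (simp add: mult_ac)
    then obtain l' where l': "(int u - m) * a * num i = int u - m + int p * l'"
      by (metis cong_iff_lin cong_sym)
    have "real p * (K * i - of_int (l + l')) = (real p * i - of_int m) + real u"
      unfolding right_diff_distrib l l' by (simp add: algebra_simps)
    also have "\<bar>\<dots>\<bar> \<le> 9/2"
    proof -
      have "real u \<le> 4" using u(1) by simp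
      with m show ?thesis by linarith
    qed
    finally have "\<bar>K * i - of_int (l + l')\<bar> \<le> 9/2 / real p"
      using p0 by (simp add: abs_mult pos_le_divide_eq mult.commute)
    then show ?thesis
      by (rule abs_cot_ge) (use K[OF i(1)] p in \<open>auto simp: field_simps\<close>)
  qed
  \<comment> \<open>The hypothesis \<open>3 * x < pi / 2\<close> of \<open>cot_triple_less\<close>
    amounts to \<open>p > 27\<close>, which \<open>p \<ge> 29\<close> provides.\<close>
  have less: "3 * cot (pi * (27/2 / real p)) < cot (pi * (9/2 / real p))"
    using cot_triple_less[of "pi * (9/2 / real p)"] p(4) p0 by (simp add: field_simps)
  have "27/2 / real p \<le> 1/2" using p(4) by simp
  then have "pi * (27/2 / real p) \<le> pi * (1/2)" by (intro mult_left_mono) auto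
  then have nonneg: "0 \<le> cot (pi * (27/2 / real p))" by (intro cot_nonneg) auto
  have "real_of_int \<bar>c i\<bar> * cot (pi * (9/2 / real p)) \<le> \<bar>of_int (c i) * cot (pi * (K * i))\<bar>"
    using large by (simp add: abs_mult mult_left_mono)
  also have "of_int (c i) * cot (pi * (K * i)) = - (\<Sum>r\<in>F - {i}. of_int (c r) * cot (pi * (K * r)))"
    using sum0 sum.remove[OF F(1) i(1), of "\<lambda>r. of_int (c r) * cot (pi * (K * r))"] by simp
  also have "\<bar>\<dots>\<bar> \<le> (\<Sum>r\<in>F - {i}. \<bar>of_int (c r) * cot (pi * (K * r))\<bar>)" by simp
  also have "\<dots> \<le> (\<Sum>r\<in>F - {i}. of_int \<bar>c i\<bar> * cot (pi * (27/2 / real p)))"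
    using small i(2) by (intro sum_mono) (auto simp: abs_mult simp del: of_int_abs simp flip: of_int_abs intro!: mult_mono)
  also have "\<dots> = real (card (F - {i})) * (of_int \<bar>c i\<bar> * cot (pi * (27/2 / real p)))" by simp
  also have "\<dots> \<le> 3 * (of_int \<bar>c i\<bar> * cot (pi * (27/2 / real p)))"
    using F(1,4) i(1) nonneg ci by (intro mult_right_mono) auto
  also have "\<dots> < of_int \<bar>c i\<bar> * cot (pi * (9/2 / real p))"
    using less ci by simp
  finally show False by simp
qed

text \<open>Greedy choice: an element \<open>x\<close> is picked and everything in conflict with it,
  including \<open>x\<close> itself by reflexivity, is discarded, which costs at most
  \<open>D\<close> elements.\<close>

lemma exists_independent_subset:
  assumes "symp bad" "reflp bad" "finite A" "\<And>x. x \<in> A \<Longrightarrow> card {y \<in> A. bad x y} \<le> D"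
    and "card A > k * D"
  shows "\<exists>F\<subseteq>A. card F = Suc k \<and> (\<forall>x\<in>F. \<forall>y\<in>F. x \<noteq> y \<longrightarrow> \<not> bad x y)"
  using assms(3-5)
proof (induction k arbitrary: A)
  case 0
  then have "A \<noteq> {}" by force
  then obtain x where "x \<in> A" by blast
  then have "{x} \<subseteq> A" "card {x} = Suc 0" "\<forall>y\<in>{x}. \<forall>z\<in>{x}. y \<noteq> z \<longrightarrow> \<not> bad y z"
    by simp_all
  then show ?case by blast
next
  case (Suc k)
  then have "A \<noteq> {}" by force
  then obtain x where x: "x \<in> A" by blast
  define A' where "A' = A - {y \<in> A. bad x y}"
  have sub: "A' \<subseteq> A" and fin': "finite A'" unfolding A'_def using Suc.prems(1) by auto
  have "card A' = card A - card {y \<in> A. bad x y}"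
    unfolding A'_def using Suc.prems(1) by (intro card_Diff_subset) auto
  with Suc.prems(2)[OF x] Suc.prems(3) have big: "card A' > k * D" by simp
  have le: "card {z \<in> A'. bad y z} \<le> D" if "y \<in> A'" for y
  proof -
    have "card {z \<in> A'. bad y z} \<le> card {z \<in> A. bad y z}"
      using Suc.prems(1) sub by (intro card_mono) auto
    also have "\<dots> \<le> D" using that sub by (intro Suc.prems(2)) blast
    finally show ?thesis .
  qed
  obtain F where F: "F \<subseteq> A'" "card F = Suc k" "\<forall>y\<in>F. \<forall>z\<in>F. y \<noteq> z \<longrightarrow> \<not> bad y z"
    using Suc.IH[OF fin' le big] by blast
  have fin: "finite F" using F(1) fin' by (rule finite_subset)
  have nbad: "\<not> bad x y \<and> \<not> bad y x" if "y \<in> F" for y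
    using that F(1) sub assms(1) unfolding A'_def by (blast dest: sympD)
  have "x \<notin> F" using nbad assms(2) by (blast dest: reflpD)
  then have "card (insert x F) = Suc (Suc k)" using F(2) fin by simp
  moreover have "insert x F \<subseteq> A" using x F(1) sub by blast
  moreover have "\<forall>y\<in>insert x F. \<forall>z\<in>insert x F. y \<noteq> z \<longrightarrow> \<not> bad y z"
    using F(3) nbad by blast
  ultimately show ?case by blast
qed

section \<open>Sets of cotangents of small rank\<close>

text \<open>This encodes that the cotangents span at most \<open>d\<close> dimensions over the
  rationals, without a formal vector space.\<close>

definition cot_rank_le :: "nat \<Rightarrow> real set \<Rightarrow> bool" where
  "cot_rank_le d S \<longleftrightarrow> (\<forall>F\<subseteq>S. card F = Suc d \<longrightarrow> cot_dependent F)"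

lemma cot_dependent_superset:
  assumes "cot_dependent F" "F \<subseteq> G" "finite G"
  shows "cot_dependent G"
proof -
  obtain c where c: "\<exists>r\<in>F. c r \<noteq> 0" "(\<Sum>r\<in>F. of_int (c r) * cot (pi * r)) = 0"
    using assms(1) unfolding cot_dependent_def by blast
  have "(\<Sum>r\<in>G. of_int (if r \<in> F then c r else 0) * cot (pi * r)) = (\<Sum>r\<in>F. of_int (c r) * cot (pi * r))"
    using assms(2,3) by (intro sum.mono_neutral_cong_right) auto
  with c assms(2) show ?thesis
    unfolding cot_dependent_def by (intro exI[of _ "\<lambda>r. if r \<in> F then c r else 0"]) auto
qed

lemma cot_rank_le_mono:
  assumes "cot_rank_le d S" "d \<le> e"
  shows "cot_rank_le e S"
  unfolding cot_rank_le_def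
proof (intro allI impI)
  fix F assume F: "F \<subseteq> S" "card F = Suc e"
  then obtain G where G: "G \<subseteq> F" "card G = Suc d"
    using assms(2) by (metis Suc_le_mono obtain_subset_with_card_n)
  then have "cot_dependent G" using F assms(1) unfolding cot_rank_le_def by blast
  with F G show "cot_dependent F"
    by (metis card.infinite cot_dependent_superset nat.simps(3))
qed

text \<open>The conjugation by \<open>1 + (N / p) t\<close> fixes the cotangents with
  \<open>p\<close> dividing \<open>num r\<close> and moves that of \<open>r0\<close>. Comparing a
  relation with its conjugate shows that the coefficient of \<open>r0\<close> is zero, so adjoining
  \<open>r0\<close> to an independent set of fixed ones keeps it independent, and their rank is at
  most \<open>d - 1\<close>.\<close>

lemma cot_rank_le_descend:
  assumes S: "S \<subseteq> {0<..1/2}" "\<And>r. r \<in> S \<Longrightarrow> real N * r = of_int (num r)" 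
    and r0: "r0 \<in> S" "\<not> int p dvd num r0"
    and p: "prime p" "p dvd N" "N > 0" and t: "\<not> p dvd t" "coprime (1 + N div p * t) N"
    and rank: "cot_rank_le d S"
  obtains d' where "d = Suc d'" "cot_rank_le d' {r \<in> S. int p dvd num r}"
proof -
  have int: "real N * r \<in> \<int>" "r \<notin> \<int>" if "r \<in> S" for r
    using S(2)[OF that] not_in_Ints_half_interval[of r] S(1) that by auto
  have indep: "cot_dependent F" if F: "finite F" "F \<subseteq> {r \<in> S. int p dvd num r}" "cot_dependent (insert r0 F)" for F
  proof -
    have p0: "p > 0" using p(1) prime_gt_0_nat by blast
    obtain c where c: "\<exists>r\<in>insert r0 F. c r \<noteq> 0" and rel: "(\<Sum>r\<in>insert r0 F. of_int (c r) * cot (pi * r)) = 0"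
      using F(3) unfolding cot_dependent_def by blast
    define K where "K = real (1 + N div p * t)"
    have FS: "r \<in> S" if "r \<in> insert r0 F" for r using that F(2) r0(1) by auto
    have r0F: "r0 \<notin> F" using F(2) r0 by auto
    have "(\<Sum>r\<in>insert r0 F. of_int (c r) * cot (pi * (K * r))) = 0"
      unfolding K_def
    proof (rule cot_relation_coprime[OF _ p(3) _ _ rel t(2)])
      fix r assume "r \<in> insert r0 F"
      from int[OF FS[OF this]] show "real N * r \<in> \<int>" "r \<notin> \<int>" by blast+
    qed (use F(1) in simp)
    then have K_rel: "of_int (c r0) * cot (pi * (K * r0)) + (\<Sum>r\<in>F. of_int (c r) * cot (pi * (K * r))) = 0"
      using F(1) r0F by simp
    have K: "K * r = r + of_int (int t * num r) / real p" if "r \<in> S" for r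
      unfolding K_def by (rule shifted_multiple[OF p(2,3) S(2)[OF that]])
    have K_cot: "cot (pi * (K * r)) = cot (pi * r)" if r: "r \<in> F" for r
    proof -
      from r F(2) obtain b where b: "num r = int p * b" by auto
      have "K * r = r + of_int (int t * b)" using K[of r] r FS p0 by (simp add: b)
      then show ?thesis using cot_plus_of_int_times_pi[of "pi * r" "int t * b"]
        by (simp only: distrib_left)
    qed
    have "(\<Sum>r\<in>F. of_int (c r) * cot (pi * (K * r))) = (\<Sum>r\<in>F. of_int (c r) * cot (pi * r))"
      by (rule sum.cong) (simp_all add: K_cot)
    moreover have "of_int (c r0) * cot (pi * r0) + (\<Sum>r\<in>F. of_int (c r) * cot (pi * r)) = 0"
      using rel F(1) r0F by simp
    ultimately have "real_of_int (c r0) * cot (pi * (K * r0)) = of_int (c r0) * cot (pi * r0)"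
      using K_rel by linarith
    moreover have "cot (pi * (K * r0)) \<noteq> cot (pi * r0)"
    proof
      assume "cot (pi * (K * r0)) = cot (pi * r0)"
      then have "K * r0 - r0 \<in> \<int>"
        using coprime_mult_in_Ints[OF t(2), of r0] int[OF r0(1)] unfolding K_def [symmetric]
        by (intro cot_pi_eqD) auto
      then obtain m where "of_int (int t * num r0) / real p = of_int m"
        unfolding K[OF r0(1)] by (auto elim: Ints_cases)
      then have "real_of_int (int t * num r0) = real_of_int (int p * m)"
        using p0 by (simp add: field_simps)
      then have "int p dvd int t * num r0" by (metis dvd_triv_left of_int_eq_iff)
      with t(1) r0(2) p(1) show False by (simp add: prime_dvd_mult_iff)
    qed
    ultimately have "c r0 = 0" by simp
    with c rel r0F F(1) show ?thesis unfolding cot_dependent_def by auto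
  qed
  show ?thesis
  proof (cases d)
    case 0
    \<comment> \<open>Rank 0 cannot occur: it would make the empty set dependent.\<close>
    then have "cot_dependent {r0}" using rank r0(1) unfolding cot_rank_le_def by auto
    then have "cot_dependent {}" using indep[of "{}"] by simp
    then show ?thesis by (simp add: cot_dependent_def)
  next
    case (Suc d')
    have "cot_dependent F" if F: "F \<subseteq> {r \<in> S. int p dvd num r}" "card F = Suc d'" for F
    proof -
      have fin: "finite F" using F(2) by (metis card.infinite nat.simps(3))
      have "card (insert r0 F) = Suc d" using fin F r0 Suc by (subst card_insert_disjoint) auto
      moreover have "insert r0 F \<subseteq> S" using F(1) r0(1) by auto
      ultimately have "cot_dependent (insert r0 F)" using rank unfolding cot_rank_le_def by blast
      with indep[OF fin F(1)] show ?thesis .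
    qed
    with Suc that show ?thesis unfolding cot_rank_le_def by blast
  qed
qed

text \<open>Four elements with one residue would be independent by
  \<open>cot_independent_same_residue\<close>, as at least five conjugations are available, against
  rank at most 3.\<close>

lemma card_same_residue_le:
  assumes S: "finite S" "S \<subseteq> {0<..1/2}" "\<And>r. r \<in> S \<Longrightarrow> real N * r = of_int (num r)"
    and q: "q dvd N" "N > 0" "\<And>r. r \<in> S \<Longrightarrow> coprime (num r) (int q)"
    and T: "T \<subseteq> {..<q}" "\<And>t. t \<in> T \<Longrightarrow> coprime (1 + N div q * t) N" "4 < card T"
    and rank: "cot_rank_le 3 S"
    and A: "A \<subseteq> S" "\<And>r s. r \<in> A \<Longrightarrow> s \<in> A \<Longrightarrow> [num r = num s] (mod int q)"
  shows "card A \<le> 3"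
proof (rule ccontr)
  assume "\<not> card A \<le> 3"
  then obtain F where F: "F \<subseteq> A" "card F = 4" "finite F"
    using obtain_subset_with_card_n[of 4 A] by force
  then have "F \<noteq> {}" by auto
  then obtain r0 where r0: "r0 \<in> F" by auto
  have FS: "r \<in> S" if "r \<in> F" for r using that F(1) A(1) by auto
  have "\<not> cot_dependent F"
  proof (rule cot_independent_same_residue[OF F(3) _ S(3)[OF FS] _ q(1,2) q(3)[OF FS[OF r0]] T(1,2)])
    show "F \<subseteq> {0<..1/2}" using FS S(2) by auto
    show "[num r = num r0] (mod int q)" if "r \<in> F" for r using that r0 F(1) A(2) by auto
    show "card F < card T" using F(2) T(3) by simp
  qed
  moreover have "cot_dependent F" using F A(1) rank unfolding cot_rank_le_def by auto
  ultimately show False by blast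
qed

lemma card_level_le_small:
  assumes S: "finite S" "S \<subseteq> {0<..1/2}" "\<And>r. r \<in> S \<Longrightarrow> real N * r = of_int (num r)"
    and q: "q dvd N" "N > 0" "\<And>r. r \<in> S \<Longrightarrow> coprime (num r) (int q)"
    and T: "T \<subseteq> {..<q}" "\<And>t. t \<in> T \<Longrightarrow> coprime (1 + N div q * t) N" "4 < card T"
    and rank: "cot_rank_le 3 S"
  shows "card S \<le> 3 * q"
proof -
  have q0: "q > 0" using q by (auto intro: Nat.gr0I)
  define A where "A a = {r \<in> S. num r mod int q = int a}" for a
  have "S \<subseteq> (\<Union>a<q. A a)"
  proof
    fix r assume "r \<in> S"
    moreover have "nat (num r mod int q) < q" "int (nat (num r mod int q)) = num r mod int q"
      using q0 by (simp_all add: nat_less_iff)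
    ultimately show "r \<in> (\<Union>a<q. A a)" unfolding A_def by (intro UN_I[of "nat (num r mod int q)"]) auto
  qed
  then have "card S \<le> card (\<Union>a<q. A a)"
    using S(1) by (intro card_mono) (auto simp: A_def)
  also have "\<dots> \<le> (\<Sum>a<q. card (A a))" by (rule card_UN_le) simp
  also have "\<dots> \<le> (\<Sum>a<q. 3)"
    by (intro sum_mono card_same_residue_le[OF S q T rank]) (auto simp: A_def cong_def)
  finally show ?thesis by simp
qed

text \<open>The bound is \<open>3 \<cdot> 1272\<close> with \<open>1272 = 2 \<cdot> 4 \<cdot> 53 \<cdot> 3\<close>: two orientations of a pair, \<open>4 \<cdot> 53\<close> small ratios, and
  three elements per residue class.\<close>
lemma card_level_le_large:
  assumes S: "finite S" "S \<subseteq> {0<..1/2}" "\<And>r. r \<in> S \<Longrightarrow> real N * r = of_int (num r)"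
      "\<And>r. r \<in> S \<Longrightarrow> \<not> int p dvd num r"
    and p: "prime p" "p dvd N" "N > 0" "p \<ge> 29"
    and T: "\<And>t t'. t < p \<Longrightarrow> t' < p \<Longrightarrow> \<not> coprime (1 + N div p * t) N \<Longrightarrow>
                \<not> coprime (1 + N div p * t') N \<Longrightarrow> t = t'"
      "4 < card {t \<in> {..<p}. coprime (1 + N div p * t) N}"
    and rank: "cot_rank_le 3 S"
  shows "card S \<le> 3816"
proof (rule ccontr)
  assume "\<not> card S \<le> 3816"
  then have big: "card S > 3 * 1272" by simp
  have pp: "prime (int p)" using p(1) by simp
  have cop: "coprime (num r) (int p)" if "r \<in> S" for r
    using prime_imp_coprime[OF pp S(4)[OF that]] by (simp only: coprime_commute)
  have card_le: "card A \<le> 3" if "A \<subseteq> S" "\<And>r s. r \<in> A \<Longrightarrow> s \<in> A \<Longrightarrow> [num r = num s] (mod int p)" for A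
    by (rule card_same_residue_le[OF S(1-3) p(2,3) cop _ _ T(2) rank that]) auto
  define W where "W = {1..4 :: int} \<times> {-26..26 :: int}"
  define B where "B r s vw = (int p dvd fst vw * num r - snd vw * num s)" for r s and vw :: "int \<times> int"
  define bad where "bad r s \<longleftrightarrow> (\<exists>vw\<in>W. B r s vw \<or> B s r vw)" for r s
  have W: "finite W" "card W = 212" by (simp_all add: W_def)
  have small: "\<not> int p dvd v" if "v \<in> {1..4}" for v
    using that p(4) zdvd_not_zless[of v "int p"] by auto
  have ex: "\<exists>F\<subseteq>S. card F = Suc 3 \<and> (\<forall>r\<in>F. \<forall>s\<in>F. r \<noteq> s \<longrightarrow> \<not> bad r s)"
  proof (rule exists_independent_subset[OF _ _ S(1) _ big])
    show "symp bad" by (auto simp: symp_def bad_def)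
    show "reflp bad"
      unfolding reflp_def bad_def by (intro allI bexI[of _ "(1, 1)"]) (simp_all add: B_def W_def)
    fix r assume r: "r \<in> S"
    have le1: "card {s \<in> S. B r s vw} \<le> 3" if vw: "vw \<in> W" for vw
    proof (rule card_le)
      fix s s' assume "s \<in> {s \<in> S. B r s vw}" "s' \<in> {s \<in> S. B r s vw}"
      then have d: "int p dvd fst vw * num r - snd vw * num s" "int p dvd fst vw * num r - snd vw * num s'"
        by (auto simp: B_def)
      then have "int p dvd (fst vw * num r - snd vw * num s') - (fst vw * num r - snd vw * num s)"
        by (rule dvd_diff[rotated])
      then have "int p dvd snd vw * (num s - num s')" by (simp add: algebra_simps)
      \<comment> \<open>\<open>W\<close> contains pairs with second entry 0; for these
        \<open>B r s vw\<close> would make \<open>p\<close> divide \<open>fst vw * num r\<close>,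
        which is impossible.\<close>
      moreover have "\<not> int p dvd snd vw"
      proof
        assume "int p dvd snd vw"
        then have "int p dvd (fst vw * num r - snd vw * num s) + snd vw * num s"
          using d(1) by (intro dvd_add dvd_mult2)
        then have "int p dvd fst vw * num r" by simp
        with pp S(4)[OF r] small[of "fst vw"] vw show False by (auto simp: prime_dvd_mult_iff W_def)
      qed
      ultimately show "[num s = num s'] (mod int p)"
        using pp by (simp add: prime_dvd_mult_iff cong_iff_dvd_diff)
    qed auto
    have le2: "card {s \<in> S. B s r vw} \<le> 3" if vw: "vw \<in> W" for vw
    proof (rule card_le)
      fix s s' assume "s \<in> {s \<in> S. B s r vw}" "s' \<in> {s \<in> S. B s r vw}"
      then have d: "int p dvd fst vw * num s - snd vw * num r" "int p dvd fst vw * num s' - snd vw * num r"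
        by (auto simp: B_def)
      then have "int p dvd (fst vw * num s - snd vw * num r) - (fst vw * num s' - snd vw * num r)"
        by (rule dvd_diff)
      then have "int p dvd fst vw * (num s - num s')" by (simp add: algebra_simps)
      then show "[num s = num s'] (mod int p)"
        using pp small[of "fst vw"] vw by (auto simp: prime_dvd_mult_iff cong_iff_dvd_diff W_def)
    qed auto
    have le: "card ({s \<in> S. B r s vw} \<union> {s \<in> S. B s r vw}) \<le> 6" if "vw \<in> W" for vw
      using card_Un_le[of "{s \<in> S. B r s vw}" "{s \<in> S. B s r vw}"] le1[OF that] le2[OF that] by linarith
    have "{s \<in> S. bad r s} = (\<Union>vw\<in>W. {s \<in> S. B r s vw} \<union> {s \<in> S. B s r vw})"
      by (auto simp: bad_def)
    then have "card {s \<in> S. bad r s} \<le> (\<Sum>vw\<in>W. card ({s \<in> S. B r s vw} \<union> {s \<in> S. B s r vw}))"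
      by (simp only: card_UN_le[OF W(1)])
    also have "\<dots> \<le> (\<Sum>vw\<in>W. 6)" by (rule sum_mono) (rule le)
    finally show "card {s \<in> S. bad r s} \<le> 1272" using W(2) by simp
  qed
  then obtain F where F: "F \<subseteq> S" "card F = Suc 3" "\<forall>r\<in>F. \<forall>s\<in>F. r \<noteq> s \<longrightarrow> \<not> bad r s" by blast
  then have FS: "r \<in> S" if "r \<in> F" for r using that by blast
  have "\<not> cot_dependent F"
  proof (rule cot_independent_no_small_ratio[OF _ _ _ _ S(3)[OF FS] S(4)[OF FS] p T(1)])
    show "finite F" using F(2) by (metis card.infinite nat.simps(3))
    show "F \<noteq> {}" using F(2) by auto
    show "F \<subseteq> {0<..1/2}" using F(1) S(2) by blast
    show "card F \<le> 4" using F(2) by simp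
    fix r s v w assume rs: "r \<in> F" "s \<in> F" "r \<noteq> s" and vw: "v \<in> {1..4 :: int}" "w \<in> {-26..26 :: int}"
    show "\<not> int p dvd v * num r - w * num s"
    proof
      assume "int p dvd v * num r - w * num s"
      then have "B r s (v, w)" by (simp add: B_def)
      moreover have "(v, w) \<in> W" using vw by (simp add: W_def)
      ultimately have "bad r s" unfolding bad_def by blast
      with F(3) rs show False by blast
    qed
  qed
  moreover have "cot_dependent F" using F rank unfolding cot_rank_le_def by auto
  ultimately show False by blast
qed

section \<open>Choice of the prime power\<close>

lemma not_coprime_prime_divisor:
  fixes a b :: nat
  assumes "\<not> coprime a b"
  obtains r where "prime r" "r dvd a" "r dvd b"
proof -
  have "gcd a b \<noteq> 1" using assms by (simp add: coprime_iff_gcd_eq_1)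
  then obtain r where "prime r" "r dvd gcd a b" using prime_factor_nat by blast
  then show ?thesis using that by simp
qed

text \<open>Since \<open>p ^ Suc j\<close> divides \<open>N\<close>, every prime divisor of
  \<open>N\<close>, \<open>p\<close> included, still divides \<open>N div p ^ j\<close> and hence
  cannot divide \<open>1 + N div p ^ j * t\<close>.\<close>

lemma coprime_one_plus_multiple_prime_power:
  fixes p N :: nat
  assumes "prime p" "p ^ Suc j dvd N" 
  shows "coprime (1 + N div p ^ j * t) N"
proof (rule ccontr)
  assume "\<not> ?thesis"
  then obtain r where r: "prime r" "r dvd 1 + N div p ^ j * t" "r dvd N"
    using not_coprime_prime_divisor by blast
  have dvd: "p ^ j dvd N" using assms(2) by (metis dvd_trans le_imp_power_dvd lessI less_imp_le)
  have "N = p ^ j * (N div p ^ j)" using dvd by simp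
  with r(1,3) have "r dvd p ^ j \<or> r dvd N div p ^ j" by (metis prime_dvd_mult_iff)
  moreover have "r dvd N div p ^ j" if "r dvd p ^ j"
  proof -
    have "r = p" using that r(1) assms(1) by (metis prime_dvd_power primes_dvd_imp_eq)
    moreover have "p dvd N div p ^ j" using assms by (metis power_Suc dvd_div_iff_mult power_not_zero not_prime_0 dvd)
    ultimately show ?thesis by simp
  qed
  ultimately have "r dvd N div p ^ j * t" by auto
  with r(2) have "r dvd 1" by (simp only: dvd_add_left_iff)
  with r(1) show False by (simp add: not_prime_unit)
qed

text \<open>A prime divisor of \<open>N\<close> other than \<open>p\<close> divides
  \<open>N div p\<close>, so a failure of coprimality is due to \<open>p\<close> alone. It also
  forces \<open>p\<close> not to divide \<open>N div p\<close>, and then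
  \<open>1 + N div p * t\<close> vanishes modulo \<open>p\<close> for one residue \<open>t\<close>
  only.\<close>

lemma not_coprime_one_plus_unique:
  fixes p N :: nat
  assumes "prime p" "p dvd N" "N > 0" and t: "t < p" "t' < p"
    and "\<not> coprime (1 + N div p * t) N" "\<not> coprime (1 + N div p * t') N"
  shows "t = t'"
proof -
  have p_dvd: "p dvd 1 + N div p * t" if nc: "\<not> coprime (1 + N div p * t) N" for t
  proof -
    obtain r where r: "prime r" "r dvd 1 + N div p * t" "r dvd N"
      using not_coprime_prime_divisor[OF nc] by blast
    have "N = p * (N div p)" using assms(2) by simp
    with r have "r dvd p \<or> r dvd N div p" by (metis prime_dvd_mult_iff)
    moreover have "\<not> r dvd N div p"
    proof
      assume "r dvd N div p"
      then have "r dvd N div p * t" by simp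
      with r(2) have "r dvd 1" by (simp only: dvd_add_left_iff)
      with r(1) show False by (simp add: not_prime_unit)
    qed
    ultimately have "r = p" using r(1) assms(1) primes_dvd_imp_eq by blast
    with r(2) show ?thesis by simp
  qed
  have 1: "\<not> p dvd N div p"
  proof
    assume "p dvd N div p"
    then have "p dvd N div p * t" by simp
    with p_dvd[OF assms(6)] have "p dvd 1" by (simp only: dvd_add_left_iff)
    with assms(1) show False by (simp add: not_prime_unit)
  qed
  have "[1 + N div p * t = 1 + N div p * t'] (mod p)"
    using p_dvd[OF assms(6)] p_dvd[OF assms(7)] by (simp add: cong_def mod_eq_0_iff_dvd)
  then have "[N div p * t = N div p * t'] (mod p)" by (simp only: cong_add_lcancel_nat)
  moreover have "coprime (N div p) p" using 1 assms(1) by (metis coprime_commute prime_imp_coprime)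
  ultimately have "[t = t'] (mod p)" by (simp add: cong_mult_lcancel_nat)
  with t show ?thesis by (metis cong_less_modulus_unique_nat)
qed

text \<open>Powers \<open>q\<close> of \<open>2, 3, 5\<close> are usable once \<open>q \<ge> 5\<close> and \<open>p q\<close> divides \<open>N\<close>; the \<open>N\<close> admitting neither these nor a prime \<open>p \<ge> 7\<close>
  divide \<open>360 = 8 \<cdot> 9 \<cdot> 5\<close>.\<close>
lemma not_dvd_360_cases:
  fixes N :: nat
  assumes "\<not> N dvd 360" "N > 0"
  obtains p where "prime p" "p \<ge> 7" "p dvd N" | "2 ^ 4 dvd N" | "3 ^ 3 dvd N" | "5 ^ 2 dvd N"
proof -
  \<comment> \<open>Some prime has larger multiplicity in \<open>N\<close> than in 360; for 2, 3, 5
    this means exponent at least 4, 3, 2.\<close>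
  obtain p :: nat where p: "prime p" "multiplicity p 360 < multiplicity p N"
    using assms multiplicity_le_imp_dvd[of N 360] by (metis gr_implies_not0 not_le)
  then have dvd: "p ^ Suc (multiplicity p 360) dvd N" by (intro multiplicity_dvd') simp
  have p_dvd: "p dvd N" using dvd by (metis dvd_mult_left power_Suc)
  have *: "p ^ k dvd N" if "p ^ (k - 1) dvd 360" "k > 0" for k
  proof -
    have "k - 1 \<le> multiplicity p 360" using that p(1) by (intro multiplicity_geI) auto
    then have "p ^ k dvd p ^ Suc (multiplicity p 360)" using that by (intro le_imp_power_dvd) simp
    then show ?thesis using dvd by (rule dvd_trans)
  qed
  consider "p \<ge> 7" | "p = 2" | "p = 3" | "p = 5"
  proof -
    have "p \<noteq> 4" "p \<noteq> 6" using p(1) prime_product[of 2 2] prime_product[of 2 3] by auto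
    then show ?thesis using that prime_ge_2_nat[OF p(1)] by (cases "p \<ge> 7") (auto simp: not_le numeral_eq_Suc less_Suc_eq)
  qed
  then show ?thesis
  proof cases
    case 1 then show ?thesis using that(1) p p_dvd by blast
  next
    case 2 then show ?thesis using *[of 4] that(2) by simp
  next
    case 3 then show ?thesis using *[of 3] that(3) by simp
  next
    case 4 then show ?thesis using *[of 2] that(4) by simp
  qed
qed

lemma common_denominator:
  fixes S :: "real set"
  assumes "finite S" "S \<subseteq> \<rat>"
  shows "\<exists>N>0. \<forall>r\<in>S. real N * r \<in> \<int>"
  using assms
proof (induction S rule: finite_induct)
  case empty
  show ?case by auto
next
  case (insert x S)
  then obtain N where N: "N > 0" "\<forall>r\<in>S. real N * r \<in> \<int>" by auto
  have "x \<in> \<rat>" using insert.prems by simp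
  then obtain a b :: int where ab: "b > 0" "x = of_int a / of_int b"
    by (rule Rats_cases')
  define M where "M = N * nat b"
  have M: "real M = of_int b * real N" using ab(1) by (simp add: M_def)
  have "real M * x = of_int (a * int N)" unfolding M using ab by (simp add: field_simps)
  then have "real M * x \<in> \<int>" by (metis Ints_of_int)
  moreover have "real M * r \<in> \<int>" if "r \<in> S" for r
    using N(2) that unfolding M mult.assoc by (metis Ints_mult Ints_of_int)
  moreover have "M > 0" using N(1) ab(1) by (simp add: M_def)
  ultimately show ?case by blast
qed

text \<open>Either a prime \<open>p \<ge> 7\<close> divides \<open>N\<close> and
  \<open>q = p\<close> leaves at least \<open>p - 1\<close> admissible \<open>t\<close>, or
  \<open>p q\<close> divides \<open>N\<close> for \<open>q\<close> one of 8, 9, 5 and every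
  \<open>t\<close> is admissible; so five conjugations always exist. The separate \<open>t\<close>
  serves \<open>cot_rank_le_descend\<close>, and the last alternative decides between the two ways
  of bounding the elements removed.\<close>

lemma exists_critical_prime:
  fixes N :: nat
  assumes "\<not> N dvd 360" "N > 0"
  obtains p j t where "prime p" "p dvd N" "p ^ j dvd N" "\<not> p dvd t" "coprime (1 + N div p * t) N"
    "4 < card {t \<in> {..<p ^ j}. coprime (1 + N div p ^ j * t) N}"
    "p ^ j \<le> 28 \<or> j = 1 \<and> p \<ge> 29"
proof -
  note result = that
  have power: thesis if "prime p" "p ^ Suc j dvd N" "4 < p ^ j" "p ^ j \<le> 28" for p j
  proof (rule result[of p j 1])
    show "p ^ j dvd N" "p dvd N" using that by (meson dvd_trans le_imp_power_dvd lessI less_imp_le, metis dvd_mult_left power_Suc)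
    have cop: "{t \<in> {..<p ^ j}. coprime (1 + N div p ^ j * t) N} = {..<p ^ j}"
      using coprime_one_plus_multiple_prime_power[OF that(1,2)] by auto
    then show "4 < card {t \<in> {..<p ^ j}. coprime (1 + N div p ^ j * t) N}" using that(3) by simp
    \<comment> \<open>As \<open>j\<close> is positive, \<open>p^2\<close> divides \<open>N\<close>,
      and so \<open>t = 1\<close> is admissible.\<close>
    have "p ^ Suc 1 dvd N"
    proof -
      have "j \<noteq> 0" using that(3) by (intro notI) simp
      then have "p ^ Suc 1 dvd p ^ Suc j" by (intro le_imp_power_dvd) simp
      with that(2) show ?thesis by (rule dvd_trans[rotated])
    qed
    from coprime_one_plus_multiple_prime_power[OF that(1) this, of 1]
    show "coprime (1 + N div p * 1) N" by simp
    show "\<not> p dvd 1" using prime_gt_1_nat[OF that(1)] by simp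
  qed (use that in auto)
  show thesis
    using assms
  proof (cases rule: not_dvd_360_cases)
    case (1 p)
    define T where "T = {t \<in> {..<p}. coprime (1 + N div p * t) N}"
    define U where "U = {t \<in> {..<p}. \<not> coprime (1 + N div p * t) N}"
    have "card U \<le> Suc 0"
      using not_coprime_one_plus_unique[OF 1(1,3) assms(2)]
      by (intro card_le_Suc0_iff_eq[THEN iffD2]) (auto simp: U_def)
    moreover have "card T + card U = p"
      using card_Un_disjoint[of T U] by (simp add: T_def U_def disjoint_iff flip: Collect_disj_eq conj_disj_distribL)
    ultimately have card: "card T \<ge> p - 1" by simp
    have "\<not> T \<subseteq> {0}" using card 1(2) card_mono[of "{0}" T] by auto
    then obtain t where t: "t \<in> T" "t \<noteq> 0" by auto
    show ?thesis
    proof (rule result[of p 1 t])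
      show "\<not> p dvd t" using t by (auto simp: T_def dest: dvd_imp_le)
      show "4 < card {t \<in> {..<p ^ 1}. coprime (1 + N div p ^ 1 * t) N}"
        using card 1(2) by (simp add: T_def)
    qed (use 1 t in \<open>auto simp: T_def\<close>)
  next
    case 2
    then show ?thesis using power[of 2 3] by simp
  next
    case 3
    then show ?thesis using power[of 3 2] by simp
  next
    case 4
    then show ?thesis using power[of 5 1] by simp
  qed
qed

text \<open>Induction on the rank. If the least common denominator \<open>N\<close> divides 360, the
  fractions are counted directly. Otherwise a critical prime \<open>p\<close> splits
  \<open>S\<close> into \<open>S0\<close>, of smaller rank, and \<open>S1\<close>, with at most 3816
  elements.\<close>

lemma card_le_of_cot_rank_le:
  assumes "finite S" "S \<subseteq> {0<..1/2}" "S \<subseteq> \<rat>" "cot_rank_le d S" "d \<le> 3"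
  shows "card S \<le> 360 + 3816 * d"
  using assms
proof (induction d arbitrary: S rule: less_induct)
  case (less d S)
  define N where "N = (LEAST N. N > 0 \<and> (\<forall>r\<in>S. real N * r \<in> \<int>))"
  have "N > 0 \<and> (\<forall>r\<in>S. real N * r \<in> \<int>)"
    unfolding N_def using common_denominator[OF less.prems(1,3)] by (rule LeastI_ex)
  then have N: "N > 0" "\<And>r. r \<in> S \<Longrightarrow> real N * r \<in> \<int>" by auto
  have N_min: "N \<le> M" if "M > 0" "\<And>r. r \<in> S \<Longrightarrow> real M * r \<in> \<int>" for M
    unfolding N_def by (rule Least_le) (use that in blast)
  define num where "num r = \<lfloor>real N * r\<rfloor>" for r
  have num: "real N * r = of_int (num r)" if "r \<in> S" for r
    using N(2)[OF that] by (auto simp: num_def elim!: Ints_cases)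
  show ?case
  proof (cases "N dvd 360")
    case True
    then obtain m where m: "360 = N * m" unfolding dvd_def by blast
    have "S \<subseteq> (\<lambda>n. real n / 360) ` {1..360}"
    proof
      fix r assume r: "r \<in> S"
      have "360 = real m * real N" using arg_cong[OF m, of real] by (simp add: mult.commute)
      then have "360 * r = real m * (real N * r)" by (simp only: mult.assoc)
      then obtain k :: int where k: "360 * r = of_int k"
        using num[OF r] by (metis of_int_mult of_int_of_nat_eq)
      have "0 < r" "r \<le> 1/2" using less.prems(2) r by auto
      then have "0 < real_of_int k" "real_of_int k \<le> 360" using k by linarith+
      then have "nat k \<in> {1..360}" "r = real (nat k) / 360" using k by auto
      then show "r \<in> (\<lambda>n. real n / 360) ` {1..360}" by blast
    qed
    then have "card S \<le> card ((\<lambda>n. real n / 360) ` {1..360})" by (intro card_mono) auto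
    also have "\<dots> \<le> card {1..360 :: nat}" by (rule card_image_le) simp
    finally show ?thesis by simp
  next
    case False
    obtain p j t where p: "prime p" "p dvd N" and q: "p ^ j dvd N"
      and t: "\<not> p dvd t" "coprime (1 + N div p * t) N"
      and T: "4 < card {t \<in> {..<p ^ j}. coprime (1 + N div p ^ j * t) N}"
      and pj: "p ^ j \<le> 28 \<or> j = 1 \<and> p \<ge> 29"
      by (rule exists_critical_prime[OF False N(1)])
    define S0 where "S0 = {r \<in> S. int p dvd num r}"
    define S1 where "S1 = {r \<in> S. \<not> int p dvd num r}"
    have S0: "finite S0" "S0 \<subseteq> {0<..1/2}" "S0 \<subseteq> \<rat>" and S1: "finite S1" "S1 \<subseteq> {0<..1/2}"
      using less.prems(1-3) unfolding S0_def S1_def by auto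
    \<comment> \<open>If \<open>p\<close> divided every \<open>num r\<close>, then
      \<open>N div p\<close> would be a smaller common denominator.\<close>
    have "S1 \<noteq> {}"
    proof
      assume "S1 = {}"
      have "real (N div p) * r \<in> \<int>" if r: "r \<in> S" for r
      proof -
        obtain b where "num r = int p * b" using \<open>S1 = {}\<close> r by (auto simp: S1_def)
        then have "real p * (real (N div p) * r) = real p * of_int b"
          using num[OF r] p(2) by (metis dvd_mult_div_cancel mult.assoc of_int_mult of_int_of_nat_eq of_nat_mult)
        then show ?thesis using p(1) by (auto simp: prime_gt_0_nat)
      qed
      moreover have "N div p > 0" using p N(1) by (simp add: div_greater_zero_iff dvd_imp_le prime_gt_0_nat)
      ultimately have "N \<le> N div p" by (intro N_min)
      moreover have "N div p < N" using N(1) prime_gt_1_nat[OF p(1)] by simp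
      ultimately show False by simp
    qed
    then obtain r0 where r0: "r0 \<in> S" "\<not> int p dvd num r0" by (auto simp: S1_def)
    obtain d' where d': "d = Suc d'" and rank0: "cot_rank_le d' S0"
      unfolding S0_def
      by (rule cot_rank_le_descend[OF less.prems(2) num r0 p N(1) t less.prems(4)])
    have "card S0 \<le> 360 + 3816 * d'"
      by (rule less.IH[OF _ S0 rank0]) (use d' less.prems(5) in auto)
    moreover have "card S1 \<le> 3816"
    proof -
      have rank1: "cot_rank_le 3 S1"
        using cot_rank_le_mono[OF less.prems(4,5)] unfolding cot_rank_le_def S1_def by blast
      have num1: "real N * r = of_int (num r)" "\<not> int p dvd num r" if "r \<in> S1" for r
        using num that by (auto simp: S1_def)
      from pj show ?thesis
      proof
        assume "p ^ j \<le> 28"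
        have "coprime (num r) (int (p ^ j))" if "r \<in> S1" for r
        proof -
          have "coprime (int p) (num r)" using num1(2)[OF that] p(1) by (intro prime_imp_coprime) auto
          then show ?thesis by (simp add: coprime_commute)
        qed
        then have "card S1 \<le> 3 * p ^ j"
          by (intro card_level_le_small[OF S1 num1(1) q N(1) _ _ _ T rank1]) auto
        with \<open>p ^ j \<le> 28\<close> show ?thesis by simp
      next
        assume "j = 1 \<and> p \<ge> 29"
        then show ?thesis
          using T not_coprime_one_plus_unique[OF p N(1)]
          by (intro card_level_le_large[OF S1 num1 p N(1) _ _ _ rank1]) auto
      qed
    qed
    moreover have "card S = card S0 + card S1"
      using less.prems(1) card_Un_disjoint[of S0 S1]
      by (simp add: S0_def S1_def disjoint_iff flip: Collect_disj_eq conj_disj_distribL)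
    ultimately show ?thesis using d' by simp
  qed
qed

section \<open>Linear dependence by elimination\<close>

lemma exists_linear_relation:
  fixes x :: "nat \<Rightarrow> 'b \<Rightarrow> 'a :: field"
  assumes "finite F" "n < card F"
  shows "\<exists>c. (\<exists>r\<in>F. c r \<noteq> 0) \<and> (\<forall>k<n. (\<Sum>r\<in>F. c r * x k r) = 0)"
  using assms
proof (induction n arbitrary: F x)
  case 0
  then have "F \<noteq> {}" by auto
  then show ?case by (intro exI[of _ "\<lambda>_. 1"]) auto
next
  case (Suc n)
  show ?case
  proof (cases "\<forall>r\<in>F. x n r = 0")
    case True
    obtain c where "\<exists>r\<in>F. c r \<noteq> 0" "\<forall>k<n. (\<Sum>r\<in>F. c r * x k r) = 0"
      using Suc.IH[of F x] Suc.prems by auto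
    with True show ?thesis by (intro exI[of _ c]) (auto simp: less_Suc_eq)
  next
    case False
    then obtain r0 where r0: "r0 \<in> F" "x n r0 \<noteq> 0" by auto
    have F': "finite (F - {r0})" "n < card (F - {r0})" using Suc.prems r0 by auto
    \<comment> \<open>The last equation is solved for the unknown at \<open>r0\<close> and
      substituted into the others; \<open>c'\<close> restores that unknown.\<close>
    obtain c where c: "\<exists>r\<in>F - {r0}. c r \<noteq> 0"
      "\<And>k. k < n \<Longrightarrow> (\<Sum>r\<in>F - {r0}. c r * (x k r - x k r0 * x n r / x n r0)) = 0"
      using Suc.IH[OF F', of "\<lambda>k r. x k r - x k r0 * x n r / x n r0"] by blast
    define s where "s = (\<Sum>r\<in>F - {r0}. c r * x n r)"
    define c' where "c' r = (if r = r0 then - s / x n r0 else c r)" for r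
    have sum: "(\<Sum>r\<in>F. c' r * x k r) = - s / x n r0 * x k r0 + (\<Sum>r\<in>F - {r0}. c r * x k r)" for k
      unfolding sum.remove[OF Suc.prems(1) r0(1)] by (auto simp: c'_def intro!: sum.cong)
    have "(\<Sum>r\<in>F. c' r * x k r) = 0" if "k < Suc n" for k
    proof (cases "k = n")
      case True
      then show ?thesis unfolding sum using r0(2) by (simp add: s_def)
    next
      case False
      then have "k < n" using that by simp
      have "(\<Sum>r\<in>F - {r0}. c r * (x k r - x k r0 * x n r / x n r0)) =
          (\<Sum>r\<in>F - {r0}. c r * x k r) - x k r0 / x n r0 * s"
        unfolding s_def sum_distrib_left sum_subtractf [symmetric]
        by (intro sum.cong refl) (simp add: algebra_simps)
      with c(2)[OF \<open>k < n\<close>] show ?thesis unfolding sum by (simp add: algebra_simps)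
    qed
    moreover have "\<exists>r\<in>F. c' r \<noteq> 0" using c(1) by (auto simp: c'_def)
    ultimately show ?thesis by blast
  qed
qed

text \<open>More cotangents than coordinates give a rational relation between the coordinate
  vectors; multiplying by a common denominator makes it integral.\<close>

lemma cot_dependent_if_rational_coordinates:
  fixes b :: "nat \<Rightarrow> real"
  assumes F: "finite F" "n < card F"
    and x: "\<And>r. r \<in> F \<Longrightarrow> cot (pi * r) = (\<Sum>k<n. of_rat (x k r) * b k)"
  shows "cot_dependent F"
proof -
  obtain c :: "real \<Rightarrow> rat" where c: "\<exists>r\<in>F. c r \<noteq> 0" "\<And>k. k < n \<Longrightarrow> (\<Sum>r\<in>F. c r * x k r) = 0"
    using exists_linear_relation[OF F, of x] by blast
  have "finite ((\<lambda>r. of_rat (c r) :: real) ` F)" "(\<lambda>r. of_rat (c r) :: real) ` F \<subseteq> \<rat>" using F by auto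
  from common_denominator[OF this] obtain N where N: "N > 0" "\<And>r. r \<in> F \<Longrightarrow> real N * of_rat (c r) \<in> \<int>"
    by blast
  define d where "d r = \<lfloor>real N * of_rat (c r)\<rfloor>" for r
  have d: "of_int (d r) = real N * of_rat (c r)" if "r \<in> F" for r
    using N(2)[OF that] by (auto simp: d_def elim!: Ints_cases)
  have "(\<Sum>r\<in>F. of_int (d r) * cot (pi * r)) = (\<Sum>r\<in>F. \<Sum>k<n. real N * b k * of_rat (c r * x k r))"
  proof (rule sum.cong[OF refl])
    fix r assume r: "r \<in> F"
    show "of_int (d r) * cot (pi * r) = (\<Sum>k<n. real N * b k * of_rat (c r * x k r))"
      unfolding d[OF r] x[OF r] sum_distrib_left
      by (intro sum.cong refl) (simp add: of_rat_mult mult_ac)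
  qed
  also have "\<dots> = (\<Sum>k<n. real N * b k * of_rat (\<Sum>r\<in>F. c r * x k r))"
    by (subst sum.swap) (simp add: of_rat_sum sum_distrib_left)
  also have "\<dots> = 0" using c(2) by simp
  finally have "(\<Sum>r\<in>F. of_int (d r) * cot (pi * r)) = 0" .
  moreover obtain r where "r \<in> F" "c r \<noteq> 0" using c(1) by blast
  then have "d r \<noteq> 0" using d[of r] N(1) by (metis mult_eq_0_iff of_int_0 of_nat_0_less_iff of_rat_eq_0_iff order_less_irrefl)
  ultimately show ?thesis using \<open>r \<in> F\<close> unfolding cot_dependent_def by blast
qed

section \<open>Angles in a space\<close>

definition real_independent :: "complex \<Rightarrow> complex \<Rightarrow> bool" where
  "real_independent u w \<longleftrightarrow> (\<forall>s t :: real. of_real s * u + of_real t * w = 0 \<longrightarrow> s = 0 \<and> t = 0)"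

lemma complex_of_real_of_rat: "complex_of_real (of_rat q) = of_rat q"
  by (cases q) (simp add: of_rat_rat)

lemma qspan2_I: "of_rat a * u + of_rat b * w \<in> qspan2 u w"
  unfolding qspan2_def by blast

text \<open>Cramer's rule: \<open>D\<close> is the determinant of the change of basis, and
  independence of \<open>u\<close> and \<open>w\<close> makes it nonzero.\<close>

lemma qspan2_basis_change:
  assumes "V = qspan2 a b" "u \<in> V" "w \<in> V" "real_independent u w"
  shows "V = qspan2 u w"
proof -
  obtain p1 p2 q1 q2 where u: "u = of_rat p1 * a + of_rat p2 * b" and w: "w = of_rat q1 * a + of_rat q2 * b"
    using assms(1-3) unfolding qspan2_def by blast
  define D where "D = p1 * q2 - p2 * q1"
  have indep: "s = 0 \<and> t = 0" if "of_rat s * u + of_rat t * w = 0" for s t :: rat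
    using assms(4) that unfolding real_independent_def
    by (metis of_rat_eq_0_iff complex_of_real_of_rat)
  have a: "of_rat D * a = of_rat q2 * u + of_rat (- p2) * w" and b: "of_rat D * b = of_rat (- q1) * u + of_rat p1 * w"
    by (simp_all add: u w D_def of_rat_diff of_rat_mult of_rat_minus algebra_simps)
  have D: "D \<noteq> 0"
  proof
    assume "D = 0"
    then have "q2 = 0 \<and> - p2 = 0" "- q1 = 0 \<and> p1 = 0" using a b by (intro indep; simp)+
    then have "u = 0" by (simp add: u)
    then show False using indep[of 1 0] by simp
  qed
  have "qspan2 u w \<subseteq> V"
  proof
    fix v assume "v \<in> qspan2 u w"
    then obtain s t where "v = of_rat s * u + of_rat t * w" unfolding qspan2_def by blast
    then have "v = of_rat (s * p1 + t * q1) * a + of_rat (s * p2 + t * q2) * b"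
      by (simp add: u w of_rat_add of_rat_mult algebra_simps)
    then show "v \<in> V" unfolding assms(1) by (simp only: qspan2_I)
  qed
  moreover have "V \<subseteq> qspan2 u w"
  proof
    fix v assume "v \<in> V"
    then obtain s t where v: "v = of_rat s * a + of_rat t * b" unfolding assms(1) qspan2_def by blast
    have "of_rat D * v = of_rat s * (of_rat D * a) + of_rat t * (of_rat D * b)" by (simp add: v algebra_simps)
    also have "\<dots> = of_rat (s * q2 - t * q1) * u + of_rat (t * p1 - s * p2) * w"
      unfolding a b by (simp add: of_rat_diff of_rat_mult of_rat_minus algebra_simps)
    finally have "v = of_rat ((s * q2 - t * q1) / D) * u + of_rat ((t * p1 - s * p2) / D) * w"
      using D by (simp add: of_rat_divide field_simps)
    then show "v \<in> qspan2 u w" by (simp only: qspan2_I)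
  qed
  ultimately show ?thesis by blast
qed

text \<open>The factor \<open>\<rho>\<close> may be negative, so \<open>r\<close> matters only modulo \<open>1\<close>.\<close>
definition has_angle :: "real \<Rightarrow> complex \<Rightarrow> complex \<Rightarrow> bool" where
  "has_angle r v1 v2 \<longleftrightarrow> v1 \<noteq> 0 \<and> (\<exists>\<rho>\<noteq>0. v2 = of_real \<rho> * cis (pi * r) * v1)"

text \<open>Expanded in \<open>u\<close> and \<open>w\<close>, the imaginary part of
  \<open>v2 * cnj v1\<close> is a rational multiple of \<open>Im (w * cnj u)\<close> alone, and its
  real part a rational combination of three fixed numbers.\<close>

lemma cot_has_angle:
  assumes V: "V = qspan2 u w" and v: "v1 \<in> V" "v2 \<in> V" "has_angle r v1 v2"
  shows "\<exists>a b c. cot (pi * r) = of_rat a * ((cmod u)\<^sup>2 / Im (w * cnj u)) + of_rat b * (Re (w * cnj u) / Im (w * cnj u))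
      + of_rat c * ((cmod w)\<^sup>2 / Im (w * cnj u))"
proof -
  obtain a b where v1: "v1 = of_rat a * u + of_rat b * w" using V v(1) unfolding qspan2_def by blast
  obtain c d where v2: "v2 = of_rat c * u + of_rat d * w" using V v(2) unfolding qspan2_def by blast
  obtain \<rho> where \<rho>: "\<rho> \<noteq> 0" "v2 = of_real \<rho> * cis (pi * r) * v1" and v10: "v1 \<noteq> 0"
    using v(3) unfolding has_angle_def by blast
  have "v2 * cnj v1 = of_real \<rho> * (v1 * cnj v1) * cis (pi * r)" unfolding \<rho>(2) by (simp add: mult_ac)
  then have "v2 * cnj v1 = of_real (\<rho> * (cmod v1)\<^sup>2) * cis (pi * r)"
    by (simp only: of_real_mult flip: complex_norm_square)
  then have re_im: "Re (v2 * cnj v1) = \<rho> * (cmod v1)\<^sup>2 * cos (pi * r)" "Im (v2 * cnj v1) = \<rho> * (cmod v1)\<^sup>2 * sin (pi * r)"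
    by simp_all
  then have cot: "cot (pi * r) = Re (v2 * cnj v1) / Im (v2 * cnj v1)"
    using \<rho>(1) v10 by (simp add: cot_def)
  note rat = complex_of_real_of_rat [symmetric]
  have Re: "Re (v2 * cnj v1) = of_rat (a * c) * (cmod u)\<^sup>2 + of_rat (a * d + b * c) * Re (w * cnj u) + of_rat (b * d) * (cmod w)\<^sup>2"
    unfolding v1 v2 rat cmod_power2 by (simp add: of_rat_add of_rat_mult power2_eq_square algebra_simps)
  have Im: "Im (v2 * cnj v1) = of_rat (a * d - b * c) * Im (w * cnj u)"
    unfolding v1 v2 rat by (simp add: of_rat_diff of_rat_mult algebra_simps)
  \<comment> \<open>If \<open>a * d - b * c\<close> or \<open>Im (w * cnj u)\<close> is zero, both
    sides are 0 by the convention for division by zero.\<close>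
  have "cot (pi * r) = of_rat (a * c / (a * d - b * c)) * ((cmod u)\<^sup>2 / Im (w * cnj u))
      + of_rat ((a * d + b * c) / (a * d - b * c)) * (Re (w * cnj u) / Im (w * cnj u))
      + of_rat (b * d / (a * d - b * c)) * ((cmod w)\<^sup>2 / Im (w * cnj u))"
    unfolding cot Re Im of_rat_divide by (simp only: add_divide_distrib times_divide_times_eq)
  then show ?thesis by blast
qed

section \<open>Lines and their rotations\<close>

lemma rline_eqI:
  assumes "v = of_real s * u" "s \<noteq> 0"
  shows "rline v = rline u"
proof -
  have "of_real t * v = of_real (t * s) * u" "of_real t * u = of_real (t / s) * v" for t
    using assms by (simp_all add: field_simps)
  then show ?thesis unfolding rline_def by blast
qed

lemma real_independent_if_rline_neq:
  assumes "u \<noteq> 0" "w \<noteq> 0" "rline u \<noteq> rline w"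
  shows "real_independent u w"
  unfolding real_independent_def
proof (intro allI impI)
  fix s t assume st: "of_real s * u + of_real t * w = 0"
  have "s = 0"
  proof (rule ccontr)
    assume s: "s \<noteq> 0"
    have "u = of_real (- t / s) * w" using st s by (simp add: field_simps add_eq_0_iff)
    moreover from this assms(1) have "- t / s \<noteq> 0" by auto
    ultimately show False using rline_eqI assms(3) by blast
  qed
  with st assms(2) show "s = 0 \<and> t = 0" by simp
qed

lemma rline_eqD:
  assumes "rline u = rline w" "u \<noteq> 0"
  obtains s where "u = of_real s * w" "s \<noteq> 0"
proof -
  have "u = of_real 1 * u" by simp
  then have "u \<in> rline u" unfolding rline_def by blast
  then obtain s where "u = of_real s * w" using assms(1) unfolding rline_def by blast
  with assms(2) that show thesis by (metis mult_zero_left of_real_0)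
qed

text \<open>A line and an angle determine the second line; hence different pairs with the same angle
  start from different lines.\<close>

lemma has_angle_rline:
  assumes "has_angle r v1 v2" "has_angle r v1' v2'" "rline v1 = rline v1'"
  shows "rline v2 = rline v2'"
proof -
  obtain \<rho> \<rho>' where \<rho>: "\<rho> \<noteq> 0" "v2 = of_real \<rho> * cis (pi * r) * v1" "\<rho>' \<noteq> 0" "v2' = of_real \<rho>' * cis (pi * r) * v1'" "v1 \<noteq> 0"
    using assms(1,2) unfolding has_angle_def by blast
  obtain s where s: "v1 = of_real s * v1'" "s \<noteq> 0" using rline_eqD[OF assms(3) \<rho>(5)] by blast
  have "v2 = of_real (\<rho> * s / \<rho>') * v2'" unfolding \<rho>(2,4) s(1) using \<rho>(3) by simp
  then show ?thesis by (rule rline_eqI) (use s(2) \<rho>(1,3) in simp)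
qed

text \<open>If the same angle occurs from three different lines, then comparing the coordinates of the third
  pair with respect to the first two shows that a multiple of the rotation preserves the space.\<close>
lemma is_CM_if_three_equal_angles:
  assumes V: "V = qspan2 a b" and r: "r \<notin> \<int>"
    and v: "v1 \<in> V" "v2 \<in> V" "v3 \<in> V" "w1 \<in> V" "w2 \<in> V" "w3 \<in> V"
    and ang: "has_angle r v1 w1" "has_angle r v2 w2" "has_angle r v3 w3"
    and neq: "rline v1 \<noteq> rline v2" "rline v1 \<noteq> rline v3" "rline v2 \<noteq> rline v3"
  shows "is_CM V"
proof -
  let ?e = "cis (pi * r)"
  obtain \<rho>1 where 1: "\<rho>1 \<noteq> 0" "w1 = of_real \<rho>1 * ?e * v1" "v1 \<noteq> 0" using ang(1) unfolding has_angle_def by blast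
  obtain \<rho>2 where 2: "\<rho>2 \<noteq> 0" "w2 = of_real \<rho>2 * ?e * v2" "v2 \<noteq> 0" using ang(2) unfolding has_angle_def by blast
  obtain \<rho>3 where 3: "\<rho>3 \<noteq> 0" "w3 = of_real \<rho>3 * ?e * v3" "v3 \<noteq> 0" using ang(3) unfolding has_angle_def by blast
  have ind: "real_independent v1 v2" using real_independent_if_rline_neq 1(3) 2(3) neq(1) by blast
  have Vv: "V = qspan2 v1 v2" by (rule qspan2_basis_change[OF V v(1,2) ind])
  have indw: "real_independent w1 w2"
    unfolding real_independent_def
  proof (intro allI impI)
    fix s t assume "of_real s * w1 + of_real t * w2 = 0"
    then have "?e * (of_real (s * \<rho>1) * v1 + of_real (t * \<rho>2) * v2) = 0"
      unfolding 1(2) 2(2) by (simp add: algebra_simps)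
    then have "of_real (s * \<rho>1) * v1 + of_real (t * \<rho>2) * v2 = 0" by simp
    then have "s * \<rho>1 = 0 \<and> t * \<rho>2 = 0" using ind unfolding real_independent_def by blast
    with 1(1) 2(1) show "s = 0 \<and> t = 0" by simp
  qed
  \<comment> \<open>Both \<open>v1, v2\<close> and their images \<open>w1, w2\<close> are rational
    bases of \<open>V\<close>, so \<open>v3\<close> has rational coordinates in the first and
    \<open>w3\<close> in the second.\<close>
  have Vw: "V = qspan2 w1 w2" by (rule qspan2_basis_change[OF V v(4,5) indw])
  obtain x y where v3: "v3 = of_rat x * v1 + of_rat y * v2" using v(3) Vv unfolding qspan2_def by blast
  obtain x' y' where w3: "w3 = of_rat x' * w1 + of_rat y' * w2" using v(6) Vw unfolding qspan2_def by blast
  note rat = complex_of_real_of_rat [symmetric]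
  have "x \<noteq> 0"
  proof
    assume "x = 0"
    then have "v3 = of_real (of_rat y) * v2" "y \<noteq> 0" using v3 3(3) by (auto simp: rat)
    then have "rline v3 = rline v2" by (intro rline_eqI) auto
    with neq(3) show False by simp
  qed
  have "y \<noteq> 0"
  proof
    assume "y = 0"
    then have "v3 = of_real (of_rat x) * v1" "x \<noteq> 0" using v3 3(3) by (auto simp: rat)
    then have "rline v3 = rline v1" by (intro rline_eqI) auto
    with neq(2) show False by simp
  qed
  have "of_real \<rho>3 * ?e * (of_rat x * v1 + of_rat y * v2) = of_rat x' * (of_real \<rho>1 * ?e * v1) + of_rat y' * (of_real \<rho>2 * ?e * v2)"
    using 1(2) 2(2) 3(2) v3 w3 by metis
  then have "?e * (of_real (\<rho>3 * of_rat x - of_rat x' * \<rho>1) * v1 + of_real (\<rho>3 * of_rat y - of_rat y' * \<rho>2) * v2) = 0"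
    unfolding rat by (simp add: algebra_simps)
  then have "of_real (\<rho>3 * of_rat x - of_rat x' * \<rho>1) * v1 + of_real (\<rho>3 * of_rat y - of_rat y' * \<rho>2) * v2 = 0"
    by simp
  then have "\<rho>3 * of_rat x - of_rat x' * \<rho>1 = 0 \<and> \<rho>3 * of_rat y - of_rat y' * \<rho>2 = 0"
    using ind unfolding real_independent_def by blast
  then have \<rho>3: "\<rho>3 = of_rat (x' / x) * \<rho>1" "\<rho>3 = of_rat (y' / y) * \<rho>2"
    using \<open>x \<noteq> 0\<close> \<open>y \<noteq> 0\<close> by (simp_all add: of_rat_divide field_simps)
  \<comment> \<open>By the two formulas for \<open>\<rho>3\<close>, \<open>l\<close> carries the
    basis \<open>v1, v2\<close> to rational multiples of \<open>w1, w2\<close>, so it preserves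
    \<open>V\<close>.\<close>
  define l where "l = of_real \<rho>3 * ?e"
  have l1: "l * v1 = of_rat (x' / x) * w1" 
    unfolding l_def 1(2) rat by (subst \<rho>3(1)) simp
  have l2: "l * v2 = of_rat (y' / y) * w2"
    unfolding l_def 2(2) rat by (subst \<rho>3(2)) simp
  have "(\<lambda>z. l * z) ` V \<subseteq> V"
  proof (rule image_subsetI)
    fix z assume "z \<in> V"
    then obtain s t where "z = of_rat s * v1 + of_rat t * v2" using Vv unfolding qspan2_def by blast
    then have "l * z = of_rat s * (l * v1) + of_rat t * (l * v2)" by (simp add: algebra_simps)
    also have "\<dots> = of_rat (s * (x' / x)) * w1 + of_rat (t * (y' / y)) * w2"
      unfolding l1 l2 of_rat_mult by simp
    finally have "l * z \<in> qspan2 w1 w2" by (simp only: qspan2_I)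
    then show "l * z \<in> V" using Vw by simp
  qed
  moreover have "l \<notin> \<rat>"
  proof
    assume "l \<in> \<rat>"
    then have "l \<in> \<real>" by (auto elim!: Rats_cases simp: rat)
    then have "\<rho>3 * sin (pi * r) = 0" unfolding l_def by (simp add: complex_is_Real_iff)
    then have "sin (pi * r) = 0" using 3(1) by simp
    then obtain n :: int where "pi * r = of_int n * pi" by (auto simp: sin_zero_iff_int2)
    then have "r = of_int n" by simp
    with r show False by simp
  qed
  ultimately show ?thesis unfolding is_CM_def by blast
qed

definition line_pairs :: "complex set \<Rightarrow> real \<Rightarrow> complex set set set" where
  "line_pairs V r = {{rline v1, rline v2} | v1 v2. v1 \<in> V \<and> v2 \<in> V \<and> has_angle r v1 v2}"

lemma card_line_pairs_le:
  assumes V: "V = qspan2 a b" and r: "r \<notin> \<int>" and CM: "\<not> is_CM V"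
  shows "finite (line_pairs V r) \<and> card (line_pairs V r) \<le> 2"
proof (rule ccontr)
  assume neg: "\<not> ?thesis"
  have "\<exists>X\<subseteq>line_pairs V r. card X = 3"
  proof (cases "finite (line_pairs V r)")
    case True
    with neg have "3 \<le> card (line_pairs V r)" by simp
    then show ?thesis by (metis obtain_subset_with_card_n)
  next
    case False
    then show ?thesis by (metis infinite_arbitrarily_large)
  qed
  then obtain P Q R where PQR: "P \<in> line_pairs V r" "Q \<in> line_pairs V r" "R \<in> line_pairs V r"
    "P \<noteq> Q" "P \<noteq> R" "Q \<noteq> R"
    by (auto simp: card_3_iff)
  obtain v1 w1 where 1: "v1 \<in> V" "w1 \<in> V" "has_angle r v1 w1" "P = {rline v1, rline w1}"
    using PQR(1) unfolding line_pairs_def by blast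
  obtain v2 w2 where 2: "v2 \<in> V" "w2 \<in> V" "has_angle r v2 w2" "Q = {rline v2, rline w2}"
    using PQR(2) unfolding line_pairs_def by blast
  obtain v3 w3 where 3: "v3 \<in> V" "w3 \<in> V" "has_angle r v3 w3" "R = {rline v3, rline w3}"
    using PQR(3) unfolding line_pairs_def by blast
  have "rline v1 \<noteq> rline v2" using has_angle_rline[OF 1(3) 2(3)] 1(4) 2(4) PQR(4) by metis
  moreover have "rline v1 \<noteq> rline v3" using has_angle_rline[OF 1(3) 3(3)] 1(4) 3(4) PQR(5) by metis
  moreover have "rline v2 \<noteq> rline v3" using has_angle_rline[OF 2(3) 3(3)] 2(4) 3(4) PQR(6) by metis
  ultimately show False
    using is_CM_if_three_equal_angles[OF V r 1(1) 2(1) 3(1) 1(2) 2(2) 3(2) 1(3) 2(3) 3(3)] CM by blast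
qed

section \<open>Reduction of angles to (0, 1/2]\<close>

lemma has_angle_swap:
  assumes "has_angle r v1 v2"
  shows "has_angle (- r) v2 v1"
proof -
  obtain \<rho> where \<rho>: "\<rho> \<noteq> 0" "v2 = of_real \<rho> * cis (pi * r) * v1" "v1 \<noteq> 0"
    using assms unfolding has_angle_def by blast
  have "cis (pi * (- r)) * cis (pi * r) = 1" by (simp add: cis_mult)
  then have "v1 = of_real (1 / \<rho>) * cis (pi * (- r)) * v2"
    unfolding \<rho>(2) using \<rho>(1) by (simp add: mult_ac)
  moreover have "v2 \<noteq> 0" using \<rho> by simp
  ultimately show ?thesis unfolding has_angle_def using \<rho>(1) by (metis divide_eq_0_iff zero_neq_one)
qed

lemma has_angle_add_1:
  assumes "has_angle r v1 v2"
  shows "has_angle (r + 1) v1 v2"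
proof -
  obtain \<rho> where \<rho>: "\<rho> \<noteq> 0" "v2 = of_real \<rho> * cis (pi * r) * v1" "v1 \<noteq> 0"
    using assms unfolding has_angle_def by blast
  have "cis (pi * (r + 1)) = - cis (pi * r)" by (simp add: distrib_left flip: cis_mult)
  then have "v2 = of_real (- \<rho>) * cis (pi * (r + 1)) * v1" by (simp add: \<rho>(2))
  then show ?thesis unfolding has_angle_def using \<rho>(1,3) by (metis neg_equal_0_iff_equal)
qed

text \<open>Representatives in \<open>(0, 1/2]\<close> suffice because pairs are unordered: swapping
  negates \<open>r\<close>, and \<open>r\<close> matters only modulo 1.\<close>

definition angle_set :: "complex set \<Rightarrow> real set" where
  "angle_set V = {r \<in> {0<..1/2} \<inter> \<rat>. \<exists>v1\<in>V. \<exists>v2\<in>V. has_angle r v1 v2}"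

lemma rational_angles_subset: "rational_angles V \<subseteq> (\<Union>r\<in>angle_set V. line_pairs V r)"
proof
  fix P assume "P \<in> rational_angles V"
  then obtain v1 v2 q where v: "v1 \<in> V" "v2 \<in> V" "v1 \<noteq> 0" "v2 \<noteq> 0" "v2 / v1 \<notin> \<real>"
    and q: "q \<in> \<rat>" "Arg (v2 / v1) = q * pi" and P: "P = {rline v1, rline v2}"
    unfolding rational_angles_def by blast
  have "v2 / v1 = of_real (cmod (v2 / v1)) * cis (pi * q)"
    using v(3,4) cis_Arg[of "v2 / v1"] unfolding q(2) by (simp add: sgn_eq mult.commute)
  then have "v2 = of_real (cmod (v2 / v1)) * cis (pi * q) * v1" using v(3) by (simp add: field_simps)
  moreover have "cmod (v2 / v1) \<noteq> 0" using v by simp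
  ultimately have ang: "has_angle q v1 v2" unfolding has_angle_def using v(3) by blast
  have "q \<noteq> 0" "q \<noteq> 1" using v(5) q(2) by (auto simp: Arg_eq_0 Arg_eq_pi complex_is_Real_iff)
  moreover have "-1 < q" "q \<le> 1" using Arg_bounded[of "v2 / v1"] unfolding q(2)
    by (simp_all add: minus_less_iff flip: mult_minus_left) (metis mult_minus1 mult_less_cancel_right_disj pi_gt_zero not_less_iff_gr_or_eq)
  \<comment> \<open>The representatives in the four ranges are \<open>q\<close>,
    \<open>1 - q\<close>, \<open>- q\<close> and \<open>q + 1\<close>; the second and third exchange
    the two vectors.\<close>
  ultimately consider "0 < q" "q \<le> 1/2" | "1/2 < q" "q < 1" | "-1/2 \<le> q" "q < 0" | "-1 < q" "q < -1/2"
    by linarith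
  then obtain r x y where r: "r \<in> {0<..1/2} \<inter> \<rat>" "x \<in> V" "y \<in> V" "has_angle r x y" "P = {rline x, rline y}"
  proof cases
    case 1
    then show ?thesis using that[of q v1 v2] ang v q(1) P by auto
  next
    case 2
    then show ?thesis using that[of "1 - q" v2 v1] has_angle_add_1[OF has_angle_swap[OF ang]] v q(1) P
      by (auto simp: insert_commute)
  next
    case 3
    then show ?thesis using that[of "- q" v2 v1] has_angle_swap[OF ang] v q(1) P
      by (auto simp: insert_commute)
  next
    case 4
    then show ?thesis using that[of "q + 1" v1 v2] has_angle_add_1[OF ang] v q(1) P by auto
  qed
  then have "r \<in> angle_set V" "P \<in> line_pairs V r" unfolding angle_set_def line_pairs_def by blast+
  then show "P \<in> (\<Union>r\<in>angle_set V. line_pairs V r)" by blast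
qed

text \<open>Here \<open>11808 = 360 + 3 * 3816\<close>. Refuting a finite subset with 11809 elements
  also yields finiteness.\<close>

lemma card_angle_set_le:
  assumes V: "V = qspan2 u w"
  shows "finite (angle_set V) \<and> card (angle_set V) \<le> 11808"
proof (rule ccontr)
  assume neg: "\<not> ?thesis"
  have "\<exists>S\<subseteq>angle_set V. finite S \<and> card S = 11809"
  proof (cases "finite (angle_set V)")
    case True
    with neg have "11809 \<le> card (angle_set V)" by simp
    then show ?thesis by (metis obtain_subset_with_card_n)
  next
    case False
    then show ?thesis by (metis infinite_arbitrarily_large)
  qed
  then obtain S where S: "S \<subseteq> angle_set V" "finite S" "card S = 11809" by blast
  have "cot_rank_le 3 S"
    unfolding cot_rank_le_def
  proof (intro allI impI)
    fix F assume F: "F \<subseteq> S" "card F = Suc 3"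
    define I where "I = Im (w * cnj u)"
    define b where "b k = (if k = 0 then (cmod u)\<^sup>2 / I else if k = 1 then Re (w * cnj u) / I else (cmod w)\<^sup>2 / I)" for k :: nat
    have "\<exists>x. cot (pi * r) = (\<Sum>k<3. of_rat (x k) * b k)" if "r \<in> F" for r
    proof -
      from that F(1) S(1) obtain v1 v2 where v: "v1 \<in> V" "v2 \<in> V" "has_angle r v1 v2"
        unfolding angle_set_def by blast
      obtain x y z where "cot (pi * r) = of_rat x * ((cmod u)\<^sup>2 / I) + of_rat y * (Re (w * cnj u) / I) + of_rat z * ((cmod w)\<^sup>2 / I)"
        using cot_has_angle[OF V v] unfolding I_def by blast
      then have "cot (pi * r) = (\<Sum>k<3. of_rat (if k = 0 then x else if k = 1 then y else z) * b k)"
        by (simp add: numeral_3_eq_3 b_def)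
      then show ?thesis by (rule exI[of _ "\<lambda>k. if k = 0 then x else if k = 1 then y else z"])
    qed
    then obtain x where "\<And>r. r \<in> F \<Longrightarrow> cot (pi * r) = (\<Sum>k<3. of_rat (x r k) * b k)" by metis
    then show "cot_dependent F"
      using F finite_subset[OF F(1) S(2)]
      by (intro cot_dependent_if_rational_coordinates[of F 3 "\<lambda>k r. x r k" b]) simp_all
  qed
  moreover have "S \<subseteq> {0<..1/2}" "S \<subseteq> \<rat>" using S(1) unfolding angle_set_def by auto
  ultimately have "card S \<le> 360 + 3816 * 3" by (intro card_le_of_cot_rank_le S(2)) simp_all
  with S(3) show False by simp
qed

theorem theorem6p1:
  fixes V :: "complex set"
  assumes "is_space V" and "\<not> is_CM V"
  shows "finite (rational_angles V) \<and> card (rational_angles V) \<le> 2 * N0 + 4"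
proof -
  obtain u w where V: "V = qspan2 u w" using assms(1) unfolding is_space_def by blast
  have S: "finite (angle_set V)" "card (angle_set V) \<le> 11808" using card_angle_set_le[OF V] by auto
  have pairs: "finite (line_pairs V r)" "card (line_pairs V r) \<le> 2" if "r \<in> angle_set V" for r
    using card_line_pairs_le[OF V not_in_Ints_half_interval assms(2)] that unfolding angle_set_def by auto
  have fin: "finite (\<Union>r\<in>angle_set V. line_pairs V r)" using S(1) pairs(1) by simp
  have "card (rational_angles V) \<le> card (\<Union>r\<in>angle_set V. line_pairs V r)"
    by (rule card_mono[OF fin rational_angles_subset])
  also have "\<dots> \<le> (\<Sum>r\<in>angle_set V. card (line_pairs V r))" by (rule card_UN_le[OF S(1)])
  also have "\<dots> \<le> (\<Sum>r\<in>angle_set V. 2)" by (rule sum_mono) (rule pairs(2))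
  also have "\<dots> \<le> 2 * 11808" using S(2) by simp
  also have "\<dots> \<le> 2 * N0 + 4"
  proof -
    \<comment> \<open>The other factors of \<open>N0\<close> already give
      \<open>2^6 * 3^4 * 5^3 = 648000\<close>, more than 11808.\<close>
    define P where "P = (\<Prod>p\<in>{p::nat. prime p \<and> 7 \<le> p \<and> p \<le> 37}. p)"
    have "0 < P" unfolding P_def by (rule prod_pos) auto
    then have "1 \<le> P ^ 2" by simp
    then show ?thesis unfolding N0_def P_def [symmetric] by simp
  qed
  finally show ?thesis using finite_subset[OF rational_angles_subset fin] by blast
qed

end
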